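(* Let $f:\mathbb R^{m\times n}\to\mathbb R$ with $m\ge n$, and assume: (1) there is $f^\star>-\infty$ with $f(\mathbf X)\ge f^\star$ for all $\mathbf X$; (2) $f$ is $L$-smooth, i.e. $\|\nabla f(\mathbf Y)-\nabla f(\mathbf X)\|_F\le L\|\mathbf Y-\mathbf X\|_F$ for all $\mathbf X,\mathbf Y$; (3) there is $\sigma>0$ such that for all $\mathbf X$, $\mathbb E[\nabla f(\mathbf X;\xi)]=\nabla f(\mathbf X)$ and $\mathbb E\|\nabla f(\mathbf X;\xi)-\nabla f(\mathbf X)\|_F^2\le\sigma^2$. Let $\eta_t=t^{-3/4}$, $\beta_t=1-t^{-1/2}$, $a:=0.2\sqrt{\max\{m,n\}}$, and let the iterates be generated, for $t\ge1$, from $\mathbf M_0=\mathbf 0$ and initial parameters $\mathbf X_1$ by $$\mathbf G_t=\nabla f(\mathbf X_t;\xi_t),\quad \mathbf M_t=\beta_t\mathbf M_{t-1}+(1-\beta_t)\mathbf G_t,\quad \hat{\mathbf M}_t=(\mathbf D_{r,t}^{1/2})^\dagger\mathbf M_t,\quad \mathbf O_t=\mathrm{NS5}(\hat{\mathbf M}_t),$$ $$\mathbf X_{t+1}=(1-\lambda_t\eta_t)\mathbf X_t-a\eta_t\mathbf O_t,\qquad \mathbf D_{r,t}=\operatorname{diag}\bigl(\operatorname{rowsum}(\mathbf M_t\odot\mathbf M_t)\bigr).$$ For the fixed horizon $T$, define $$\varepsilon_{\mathrm{ns}}:=\varepsilon_{\mathrm{ns},T}=\max_{1\le t\le T}\bigl\|\mathrm{NS5}(\hat{\mathbf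 M}_t)-\operatorname{Orth}(\hat{\mathbf M}_t)\bigr\|_2 .$$ Then $\varepsilon_{\mathrm{ns}}<1$. Suppose moreover that $$0\le\rho<\frac{a(1-\varepsilon_{\mathrm{ns}})}{\sqrt m},\qquad 0\le\lambda_t\le\frac{\rho}{\|\mathbf X_1\|_F+4a(1+\varepsilon_{\mathrm{ns}})\sqrt n}\,t^{-1/4}.$$ Then, for every $T\ge1$, $$\frac1T\sum_{t=1}^T\mathbb E\|\nabla f(\mathbf X_t)\|_F\le\frac{f(\mathbf X_1)-f^\star+C_{1,\rho}^{\mathrm{ns}}(1+\ln T)+C_{2,\rho}^{\mathrm{ns}}}{\bigl(a(1-\varepsilon_{\mathrm{ns}})/\sqrt m-\rho\bigr)\,T^{1/4}},$$ where $$C_{1,\rho}^{\mathrm{ns}}=\frac aL\Bigl(2\sqrt2\,L^2\bigl(a(1+\varepsilon_{\mathrm{ns}})\sqrt n+\rho\bigr)^2+\sigma^2\Bigr)+aL\Bigl(\frac{1-\varepsilon_{\mathrm{ns}}}{\sqrt m}+(1+\varepsilon_{\mathrm{ns}})\sqrt n\Bigr)^2,$$ $$C_{2,\rho}^{\mathrm{ns}}=\frac{a\sigma^2}{L}+\frac{3L}{2}\bigl(a(1+\varepsilon_{\mathrm{ns}})\sqrt n+\rho\bigr)^2.$$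
   Context: $f(\mathbf X)=\mathbb E_{\xi\sim\mathcal D}[f(\mathbf X;\xi)]$ is a possibly nonconvex stochastic objective, where the sample $\xi$ is independent of $\mathbf X$; $\xi_t$ is the sample drawn at iteration $t$, and the stochastic gradient noise at iteration $t$ is independent of the past. The quantity $\varepsilon_{\mathrm{ns}}$ is the maximum approximation error along the algorithmic trajectory up to the horizon $T$ and enters the conditions and the bound as a constant. For a nonzero matrix with compact SVD $\mathbf A=\mathbf U\Sigma\mathbf V^\top$, $\operatorname{Orth}(\mathbf A):=\mathbf U\mathbf V^\top$; $\operatorname{Orth}(\mathbf 0):=\mathbf 0$. $\odot$ is the entrywise product, $\operatorname{rowsum}(\mathbf A)\in\mathbb R^m$ the vector of row sums, $^\dagger$ the Moore–Penrose pseudoinverse (so $\hat{\mathbf M}_t$ is $\mathbf M_t$ with each nonzero row scaled to unit Euclidean norm and zero rows left unchanged); $\|\cdot\|_F$ is the Frobenius norm and $\|\cdot\|_2$ the operator norm. The five-step pre-scaled Newton–Schulz map is $\mathrm{NS5}(\mathbf A):=\mathbf Y^{(5)}(\mathbf A)$, where $\mathbf Y^{(0)}(\mathbf A):=\mathbf A/\max\{1,\|\mathbf A\|_F\}$ and, for $k=0,\dots,4$, $\mathbf Y^{(k+1)}=p_{\mathrm{ns}}\bigl(\mathbf Y^{(k)}(\mathbf Y^{(k)})^\top\bigr)\mathbf Y^{(k)}$ with $p_{\mathrm{ns}}(\mathbf Z):=\frac{15}{8}\mathbf I_m-\frac54\mathbf Z+\frac38\mathbf Z^2$. *)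

theory Defs
  imports "HOL-Analysis.Analysis" "HOL-Probability.Probability"
begin

text \<open>
  An m x n real matrix is an element of \<open>real ^ 'n ^ 'm\<close>.  On this type \<^const>\<open>norm\<close> is the
  Frobenius norm and \<^const>\<open>inner\<close> the trace inner product, so \<^const>\<open>gderiv\<close> is the usual
  matrix gradient.
\<close>

definition op_norm :: "real ^ 'n ^ 'm \<Rightarrow> real" where
  "op_norm A = onorm (\<lambda>x. A *v x)"

definition hadamard :: "real ^ 'n ^ 'm \<Rightarrow> real ^ 'n ^ 'm \<Rightarrow> real ^ 'n ^ 'm" where
  "hadamard A B = (\<chi> i j. A $ i $ j * B $ i $ j)"

definition rowsum :: "real ^ 'n ^ 'm \<Rightarrow> real ^ 'm" where
  "rowsum A = (\<chi> i. \<Sum>j\<in>UNIV. A $ i $ j)"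

definition diag_mat :: "real ^ 'm \<Rightarrow> real ^ 'm ^ 'm" where
  "diag_mat v = (\<chi> i j. if i = j then v $ i else 0)"

text \<open>
  The symmetric positive semidefinite square root; it exists and is unique whenever \<open>A\<close> is
  symmetric positive semidefinite, which is the only case in which it is used.
\<close>

definition psd_sqrt :: "real ^ 'm ^ 'm \<Rightarrow> real ^ 'm ^ 'm" where
  "psd_sqrt A = (THE B. transpose B = B \<and> (\<forall>x. 0 \<le> x \<bullet> (B *v x)) \<and> B ** B = A)"

text \<open>The Moore-Penrose pseudoinverse, given by the four Penrose equations.\<close>

definition pinv :: "real ^ 'n ^ 'm \<Rightarrow> real ^ 'm ^ 'n" where
  "pinv A = (THE B. A ** B ** A = A \<and> B ** A ** B = B \<and>
                    transpose (A ** B) = A ** B \<and> transpose (B ** A) = B ** A)"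

definition outer :: "real ^ 'm \<Rightarrow> real ^ 'n \<Rightarrow> real ^ 'n ^ 'm" where
  "outer u v = (\<chi> i j. u $ i * v $ j)"

text \<open>
  The rank \<open>r\<close> depends on the matrix, so the factors of a compact SVD are given by their columns:
  \<open>u i\<close> and \<open>v i\<close>, for \<open>i < r\<close>, are the columns of U and V, and \<open>s i\<close> the diagonal entries
  of \<open>\<Sigma>\<close>.  Thus \<open>U \<Sigma> V\<^sup>T\<close> is \<open>\<Sum>i<r. s i *\<^sub>R outer (u i) (v i)\<close> and \<open>U V\<^sup>T\<close> is
  \<open>\<Sum>i<r. outer (u i) (v i)\<close>.
\<close>

definition compact_svd ::
    "real ^ 'n ^ 'm \<Rightarrow> nat \<Rightarrow> (nat \<Rightarrow> real ^ 'm) \<Rightarrow> (nat \<Rightarrow> real) \<Rightarrow> (nat \<Rightarrow> real ^ 'n) \<Rightarrow> bool" where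
  "compact_svd A r u s v \<longleftrightarrow>
     (\<forall>i<r. 0 < s i) \<and>
     (\<forall>i<r. \<forall>j<r. u i \<bullet> u j = (if i = j then 1 else 0)) \<and>
     (\<forall>i<r. \<forall>j<r. v i \<bullet> v j = (if i = j then 1 else 0)) \<and>
     A = (\<Sum>i<r. s i *\<^sub>R outer (u i) (v i))"

text \<open>A compact SVD always exists, and \<open>U V\<^sup>T\<close> does not depend on which one is chosen.\<close>

definition Orth :: "real ^ 'n ^ 'm \<Rightarrow> real ^ 'n ^ 'm" where
  "Orth A = (if A = 0 then 0
     else (SOME Q. \<exists>r u s v. compact_svd A r u s v \<and> Q = (\<Sum>i<r. outer (u i) (v i))))"

definition p_ns :: "real ^ 'm ^ 'm \<Rightarrow> real ^ 'm ^ 'm" where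
  "p_ns Z = (15/8) *\<^sub>R mat 1 - (5/4) *\<^sub>R Z + (3/8) *\<^sub>R (Z ** Z)"

primrec ns_iter :: "nat \<Rightarrow> real ^ 'n ^ 'm \<Rightarrow> real ^ 'n ^ 'm" where
  "ns_iter 0 A = (1 / max 1 (norm A)) *\<^sub>R A"
| "ns_iter (Suc k) A = p_ns (ns_iter k A ** transpose (ns_iter k A)) ** ns_iter k A"

definition NS5 :: "real ^ 'n ^ 'm \<Rightarrow> real ^ 'n ^ 'm" where
  "NS5 A = ns_iter 5 A"

definition row_normalize :: "real ^ 'n ^ 'm \<Rightarrow> real ^ 'n ^ 'm" where
  "row_normalize M = pinv (psd_sqrt (diag_mat (rowsum (hadamard M M)))) ** M"

text \<open>The maximal approximation error up to the horizon along one trajectory \<open>Mh 1, Mh 2, \<dots>\<close>.\<close>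

definition ns_error :: "nat \<Rightarrow> (nat \<Rightarrow> real ^ 'n ^ 'm) \<Rightarrow> real" where
  "ns_error T Mh = Max ((\<lambda>t. op_norm (NS5 (Mh t) - Orth (Mh t))) ` {1..T})"

definition C1_ns :: "real \<Rightarrow> real \<Rightarrow> real \<Rightarrow> real \<Rightarrow> real \<Rightarrow> real \<Rightarrow> real \<Rightarrow> real" where
  "C1_ns m n a L sig eps rho =
     (a / L) * (2 * sqrt 2 * L\<^sup>2 * (a * (1 + eps) * sqrt n + rho)\<^sup>2 + sig\<^sup>2)
     + a * L * ((1 - eps) / sqrt m + (1 + eps) * sqrt n)\<^sup>2"

definition C2_ns :: "real \<Rightarrow> real \<Rightarrow> real \<Rightarrow> real \<Rightarrow> real \<Rightarrow> real \<Rightarrow> real" where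
  "C2_ns n a L sig eps rho =
     a * sig\<^sup>2 / L + (3 * L / 2) * (a * (1 + eps) * sqrt n + rho)\<^sup>2"

end

(* The momentum error err_t = grad f (X_t) - M_t and the row-normalized Newton-Schulz direction are
treated separately.  In a compact SVD of the row-normalized momentum N, the iteration acts on each
singular value by x -> (15 x - 10 x^3 + 3 x^5) / 8, which maps (0, 1] to itself; hence the image has
operator distance less than 1 from Orth N and Frobenius norm at most sqrt n, and its inner product
with the momentum M is at least (1 - eps) / sqrt m times the norm of M.  The state before step t depends
on earlier samples only, so the mean square v_t of the momentum error satisfies
v_t <= (1 - t^(-1/2)) v_(t-1) + C / t, which bounds the sum of t^(-1/2) v_t by a multiple of
1 + ln T.  Since lam_t times the norm of X_t never exceeds rho, the descent lemma, Young's inequality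
t^(-3/4) g |err_t| <= L g^2 / (2 t) + t^(-1/2) |err_t|^2 / (2 L) and telescoping give the rate. *)

theory Submission
  imports Defs "HOL-Real_Asymp.Real_Asymp"
begin

section \<open>Row normalization\<close>

text \<open>Two obstacles shape the proof. The Newton-Schulz error is random, whereas the bound
  needs a number; so \<open>eps\<close> is any almost sure upper bound of \<open>ns_error\<close>,
  and the alignment of the direction with the momentum is available almost surely. And the momentum
  error needs a conditional mean: independence of the state from the fresh sample is put in the form
  of a product law, so that Fubini for nonnegative integrals averages out the sample with the state
  frozen. Integrability of the squared error then comes out of the same induction as the recursion.
  Constants: \<open>sqrt m\<close> bounds the Frobenius norm, hence every singular value, of the
  row-normalized momentum. The 4 in the condition on \<open>lam\<close> comes from t^(-3/4) <= 4
  (t^(1/4) - (t-1)^(1/4)): the iterates grow at most like t^(1/4), which the factor t^(-1/4)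
  cancels. The factor 2 sqrt 2 = 2^(3/2) pays for replacing t^(-3/2) by (t+1)^(-3/2), and the 3 in
  \<open>C2_ns\<close> bounds the sum of t^(-3/2). The descent argument itself is abstract: it sees
  the direction as a bounded measurable map aligned with its argument.\<close>

lemma diag_mat_mult_vec: "(diag_mat d *v x) $ i = d $ i * x $ i"
  by (simp add: diag_mat_def matrix_vector_mult_def if_distrib[of "\<lambda>z. z * _"] cong: if_cong)

lemma diag_mat_mult_axis: "diag_mat d *v axis i 1 = (d $ i) *\<^sub>R axis i 1"
  by (simp add: vec_eq_iff diag_mat_mult_vec axis_def)

lemma transpose_diag_mat: "transpose (diag_mat d) = diag_mat d"
  by (auto simp: vec_eq_iff transpose_def diag_mat_def)

lemma diag_mat_mult: "diag_mat d ** diag_mat e = diag_mat (\<chi> i. d $ i * e $ i)"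
  by (simp add: matrix_eq vec_eq_iff diag_mat_mult_vec flip: matrix_vector_mul_assoc)

lemma symmetric_dot_matrix:
  fixes B :: "real ^ 'm ^ 'm"
  assumes "transpose B = B"
  shows "x \<bullet> (B *v y) = (B *v x) \<bullet> y"
  by (metis assms dot_lmul_matrix transpose_matrix_vector)

text \<open>Since \<open>psd_sqrt\<close> is a definite description, the work lies in uniqueness:
  any competing root must act on each unit vector as the diagonal one does.\<close>

lemma psd_sqrt_diag_mat:
  fixes d :: "real ^ 'm"
  assumes d: "\<And>i. 0 \<le> d $ i"
  shows "psd_sqrt (diag_mat d) = diag_mat (\<chi> i. sqrt (d $ i))"
  unfolding psd_sqrt_def
proof (rule the_equality)
  show "transpose (diag_mat (\<chi> i. sqrt (d $ i))) = diag_mat (\<chi> i. sqrt (d $ i)) \<and>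
    (\<forall>x. 0 \<le> x \<bullet> (diag_mat (\<chi> i. sqrt (d $ i)) *v x)) \<and>
    diag_mat (\<chi> i. sqrt (d $ i)) ** diag_mat (\<chi> i. sqrt (d $ i)) = diag_mat d"
    using d by (simp add: transpose_diag_mat diag_mat_mult inner_vec_def diag_mat_mult_vec
        sum_nonneg mult.left_commute[of _ "sqrt _"])
next
  fix B :: "real ^ 'm ^ 'm"
  assume "transpose B = B \<and> (\<forall>x. 0 \<le> x \<bullet> (B *v x)) \<and> B ** B = diag_mat d"
  then have sym: "transpose B = B" and psd: "\<And>x. 0 \<le> x \<bullet> (B *v x)"
    and sq: "B ** B = diag_mat d"
    by auto
  have eig: "B *v axis i 1 = sqrt (d $ i) *\<^sub>R axis i 1" for i
  proof -
    define c where "c = sqrt (d $ i)"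
    \<comment> \<open>\<open>(B + c) (B - c)\<close> annihilates the \<open>i\<close>-th unit vector, so \<open>y\<close> is an eigenvector of
      \<open>B\<close> for the eigenvalue \<open>- c\<close>, which positive semidefiniteness rules out.\<close>
    define y where "y = B *v axis i 1 - c *\<^sub>R axis i 1"
    have BB: "B *v (B *v axis i 1) = (c * c) *\<^sub>R axis i 1"
      using d by (simp add: matrix_vector_mul_assoc sq diag_mat_mult_axis c_def)
    have By: "B *v y = - c *\<^sub>R y"
      by (simp add: y_def matrix_vector_mult_diff_distrib matrix_vector_mult_scaleR BB algebra_simps)
    have "y = 0"
    proof (cases "c = 0")
      case True
      have "y \<bullet> y = axis i 1 \<bullet> (B *v (B *v axis i 1))"
        by (simp add: y_def True symmetric_dot_matrix[OF sym])
      then show ?thesis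
        by (simp add: BB True)
    next
      case False
      then have "0 < c" using d by (simp add: c_def less_le)
      moreover have "0 \<le> - c * (y \<bullet> y)"
        using psd[of y] by (simp add: By)
      ultimately have "y \<bullet> y \<le> 0"
        by (simp add: mult_le_0_iff)
      then show ?thesis by (metis inner_ge_zero inner_eq_zero_iff order_antisym)
    qed
    then show ?thesis by (simp add: y_def c_def)
  qed
  have "column i B = column i (diag_mat (\<chi> i. sqrt (d $ i)))" for i
    using eig[of i] diag_mat_mult_axis[of "\<chi> i. sqrt (d $ i)" i]
    by (simp add: matrix_vector_mult_basis)
  then show "B = diag_mat (\<chi> i. sqrt (d $ i))"
    by (simp add: vec_eq_iff column_def)
qed

text \<open>For two solutions \<open>B\<close> and \<open>C\<close>, \<open>A ** B\<close> and
  \<open>A ** C\<close> are the same orthogonal projection onto the range of \<open>A\<close>, and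
  likewise \<open>B ** A = C ** A\<close>; hence B = BAB = CAB = CAC = C.\<close>

lemma pinv_eqI:
  fixes A :: "real ^ 'n ^ 'm"
  assumes B: "A ** B ** A = A" "B ** A ** B = B"
    "transpose (A ** B) = A ** B" "transpose (B ** A) = B ** A"
  shows "pinv A = B"
  unfolding pinv_def
proof (rule the_equality)
  show "A ** B ** A = A \<and> B ** A ** B = B \<and>
    transpose (A ** B) = A ** B \<and> transpose (B ** A) = B ** A"
    using B by blast
next
  fix C :: "real ^ 'm ^ 'n"
  assume "A ** C ** A = A \<and> C ** A ** C = C \<and>
    transpose (A ** C) = A ** C \<and> transpose (C ** A) = C ** A"
  then have C: "A ** C ** A = A" "C ** A ** C = C"
    "transpose (A ** C) = A ** C" "transpose (C ** A) = C ** A"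
    by auto
  have AB: "A ** B = A ** C"
  proof -
    have "A ** B = transpose (A ** C ** (A ** B))"
      using B(3) C(1) by (simp add: matrix_mul_assoc)
    also have "\<dots> = A ** B ** (A ** C)"
      using B(3) C(3) by (simp add: matrix_transpose_mul)
    also have "\<dots> = A ** C"
      using B(1) by (simp add: matrix_mul_assoc)
    finally show ?thesis .
  qed
  have BA: "B ** A = C ** A"
  proof -
    have "B ** A = transpose (B ** A ** (C ** A))"
      using B(4) C(1) by (metis matrix_mul_assoc)
    also have "\<dots> = C ** A ** (B ** A)"
      using B(4) C(4) by (simp add: matrix_transpose_mul)
    also have "\<dots> = C ** A"
      using B(1) by (metis matrix_mul_assoc)
    finally show ?thesis .
  qed
  show "C = B"
    by (metis AB BA B(2) C(2) matrix_mul_assoc)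
qed

text \<open>The convention \<open>inverse 0 = 0\<close> is exactly how the pseudoinverse treats zero
  entries; for the row norms it leaves zero rows unchanged.\<close>

lemma pinv_diag_mat: "pinv (diag_mat d) = diag_mat (\<chi> i. inverse (d $ i))"
proof (rule pinv_eqI)
  have inv: "x = 0 \<or> x * inverse x = 1" "x = 0 \<or> inverse x * x = 1" for x :: real
    using left_inverse[of x] right_inverse[of x] by blast+
  show "diag_mat d ** diag_mat (\<chi> i. inverse (d $ i)) ** diag_mat d = diag_mat d"
    "diag_mat (\<chi> i. inverse (d $ i)) ** diag_mat d ** diag_mat (\<chi> i. inverse (d $ i)) =
      diag_mat (\<chi> i. inverse (d $ i))"
    unfolding diag_mat_mult using inv by (simp_all add: diag_mat_def vec_eq_iff)
qed (simp_all add: diag_mat_mult transpose_diag_mat)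

lemma row_normalize_row: "row_normalize M $ i = inverse (norm (M $ i)) *\<^sub>R M $ i"
proof -
  have nonneg: "0 \<le> rowsum (hadamard M M) $ i" for i
    by (auto simp: rowsum_def hadamard_def intro!: sum_nonneg)
  have sqrt: "sqrt (rowsum (hadamard M M) $ i) = norm (M $ i)"
    by (simp add: rowsum_def hadamard_def norm_vec_def L2_set_def power2_eq_square)
  show ?thesis
    unfolding row_normalize_def psd_sqrt_diag_mat[OF nonneg] pinv_diag_mat
    by (simp add: vec_eq_iff sqrt diag_mat_def matrix_matrix_mult_def
        if_distrib[of "\<lambda>z. z * _"] cong: if_cong)
qed

lemma norm_matrix_square_rows: "(norm A)\<^sup>2 = (\<Sum>i\<in>UNIV. (norm (A $ i))\<^sup>2)"
  for A :: "real ^ 'n ^ 'm"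
  by (simp add: norm_vec_def L2_set_def sum_nonneg)

lemma norm_row_normalize_le: "norm (row_normalize M) \<le> sqrt (real CARD('m))"
  for M :: "real ^ 'n ^ 'm"
proof -
  have "(norm (row_normalize M $ i))\<^sup>2 \<le> 1" for i
    by (cases "M $ i = 0") (simp_all add: row_normalize_row)
  then have "(norm (row_normalize M))\<^sup>2 \<le> (\<Sum>i\<in>(UNIV :: 'm set). 1)"
    unfolding norm_matrix_square_rows by (intro sum_mono)
  then show ?thesis
    by (simp add: real_le_rsqrt)
qed

text \<open>Normalization is discontinuous at matrices with a zero row, so measurability is checked
  entry by entry instead of through continuity.\<close>

lemma borel_measurable_row_normalize [measurable]:
  "row_normalize \<in> borel_measurable (borel :: (real ^ 'n ^ 'm) measure)"
proof -
  have [measurable]: "(\<lambda>M :: real ^ 'n ^ 'm. M $ i $ j) \<in> borel_measurable borel" for i j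
    by (intro borel_measurable_continuous_onI continuous_intros)
  have [measurable]: "(\<lambda>M :: real ^ 'n ^ 'm. norm (M $ i)) \<in> borel_measurable borel" for i
    by (intro borel_measurable_continuous_onI continuous_intros)
  show ?thesis
    by (subst borel_measurable_euclidean_space)
      (auto simp: Basis_vec_def inner_axis row_normalize_row)
qed

section \<open>Singular values and the Newton-Schulz iteration\<close>

definition orthonormal_seq :: "nat \<Rightarrow> (nat \<Rightarrow> 'a :: real_inner) \<Rightarrow> bool" where
  "orthonormal_seq r u \<longleftrightarrow> (\<forall>i<r. \<forall>j<r. u i \<bullet> u j = (if i = j then 1 else 0))"

text \<open>The coefficients are a separate argument and carry no sign condition, so that a matrix,
  its Newton-Schulz image, its orthogonal factor and their differences can all be written over one
  pair of families.\<close>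

definition svd_sum ::
    "nat \<Rightarrow> (nat \<Rightarrow> real ^ 'm) \<Rightarrow> (nat \<Rightarrow> real) \<Rightarrow> (nat \<Rightarrow> real ^ 'n) \<Rightarrow> real ^ 'n ^ 'm" where
  "svd_sum r u c v = (\<Sum>k<r. c k *\<^sub>R outer (u k) (v k))"

lemma orthonormal_seqD:
  "orthonormal_seq r u \<Longrightarrow> i < r \<Longrightarrow> j < r \<Longrightarrow> u i \<bullet> u j = (if i = j then 1 else 0)"
  by (auto simp: orthonormal_seq_def)

lemma inner_sum_orthonormal:
  assumes "orthonormal_seq r u" "k < r"
  shows "u k \<bullet> (\<Sum>l<r. c l *\<^sub>R u l) = c k"
proof -
  have "u k \<bullet> (\<Sum>l<r. c l *\<^sub>R u l) = (\<Sum>l<r. if l = k then c l else 0)"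
    unfolding inner_sum_right
    by (rule sum.cong) (use assms in \<open>auto simp: orthonormal_seqD\<close>)
  then show ?thesis using assms(2) by simp
qed

lemma norm_sum_orthonormal:
  assumes "orthonormal_seq r u"
  shows "(norm (\<Sum>k<r. c k *\<^sub>R u k))\<^sup>2 = (\<Sum>k<r. (c k)\<^sup>2)"
  unfolding power2_norm_eq_inner inner_sum_left
  by (rule sum.cong) (auto simp: inner_sum_orthonormal[OF assms] power2_eq_square)

lemma bessel_inequality:
  assumes "orthonormal_seq r u"
  shows "(\<Sum>k<r. (u k \<bullet> x)\<^sup>2) \<le> (norm x)\<^sup>2"
proof -
  define p where "p = (\<Sum>k<r. (u k \<bullet> x) *\<^sub>R u k)"
  have p: "(norm p)\<^sup>2 = (\<Sum>k<r. (u k \<bullet> x)\<^sup>2)"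
    unfolding p_def by (rule norm_sum_orthonormal[OF assms])
  have "p \<bullet> x = (\<Sum>k<r. (u k \<bullet> x)\<^sup>2)"
    by (simp add: p_def inner_sum_left power2_eq_square)
  then have "(norm (x - p))\<^sup>2 = (norm x)\<^sup>2 - (\<Sum>k<r. (u k \<bullet> x)\<^sup>2)"
    using p by (simp add: power2_norm_eq_inner inner_diff inner_commute)
  then show ?thesis
    by (metis diff_ge_0_iff_ge zero_le_power2)
qed

text \<open>Double counting: the squared coordinates of the family sum to \<open>r\<close>, while
  Bessel allows each basis vector at most 1. This stops the deflation below and gives the
  \<open>sqrt n\<close> bound for \<open>NS5\<close>.\<close>

lemma orthonormal_seq_length:
  fixes u :: "nat \<Rightarrow> 'a :: euclidean_space"
  assumes "orthonormal_seq r u"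
  shows "r \<le> DIM('a)"
proof -
  have "real r = (\<Sum>k<r. \<Sum>b\<in>Basis. (u k \<bullet> b)\<^sup>2)"
    using assms by (simp add: orthonormal_seqD power2_eq_square flip: euclidean_inner)
  also have "\<dots> = (\<Sum>b\<in>Basis. \<Sum>k<r. (u k \<bullet> b)\<^sup>2)"
    by (rule sum.swap)
  also have "\<dots> \<le> (\<Sum>b\<in>(Basis :: 'a set). (norm b)\<^sup>2)"
    by (intro sum_mono bessel_inequality assms)
  finally show ?thesis by simp
qed

lemma outer_mult_vec: "outer u v *v x = (v \<bullet> x) *\<^sub>R u"
  by (simp add: vec_eq_iff outer_def matrix_vector_mult_def inner_vec_def sum_distrib_left ac_simps)

lemma sum_matrix_mult_vec: "(\<Sum>i\<in>I. A i) *v x = (\<Sum>i\<in>I. A i *v x)"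
  for A :: "'i \<Rightarrow> real ^ 'n ^ 'm"
  by (induction I rule: infinite_finite_induct) (auto simp: matrix_vector_mult_add_rdistrib)

lemma svd_sum_mult_vec: "svd_sum r u c v *v x = (\<Sum>k<r. (c k * (v k \<bullet> x)) *\<^sub>R u k)"
  by (simp add: svd_sum_def sum_matrix_mult_vec outer_mult_vec scaleR_matrix_vector_assoc[symmetric])

lemma transpose_svd_sum: "transpose (svd_sum r u c v) = svd_sum r v c u"
  by (simp add: svd_sum_def transpose_def vec_eq_iff outer_def mult_ac)

lemma svd_sum_mult_svd_sum:
  assumes "orthonormal_seq r v"
  shows "svd_sum r u c v ** svd_sum r v d w = svd_sum r u (\<lambda>k. c k * d k) w"
proof -
  have "v k \<bullet> (\<Sum>l<r. (d l * (w l \<bullet> x)) *\<^sub>R v l) = d k * (w k \<bullet> x)" if "k < r" for k x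
    by (rule inner_sum_orthonormal[OF assms that])
  then show ?thesis
    unfolding matrix_eq matrix_vector_mul_assoc[symmetric] svd_sum_mult_vec
    by (auto intro!: sum.cong)
qed

lemma svd_sum_mult_singular_vec:
  assumes "orthonormal_seq r v" "k < r"
  shows "svd_sum r u c v *v v k = c k *\<^sub>R u k"
proof -
  have "svd_sum r u c v *v v k = (\<Sum>l<r. if l = k then c l *\<^sub>R u l else 0)"
    unfolding svd_sum_mult_vec
    by (rule sum.cong) (use assms in \<open>auto simp: orthonormal_seqD\<close>)
  then show ?thesis using assms(2) by simp
qed

lemma svd_sum_row: "svd_sum r u c v $ i = (\<Sum>k<r. (c k * u k $ i) *\<^sub>R v k)"
  by (simp add: svd_sum_def vec_eq_iff outer_def mult_ac)

lemma norm_svd_sum: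
  assumes u: "orthonormal_seq r u" and v: "orthonormal_seq r v"
  shows "(norm (svd_sum r u c v))\<^sup>2 = (\<Sum>k<r. (c k)\<^sup>2)"
proof -
  have "(norm (svd_sum r u c v))\<^sup>2 = (\<Sum>i\<in>UNIV. \<Sum>k<r. (c k)\<^sup>2 * (u k $ i)\<^sup>2)"
    by (simp add: norm_matrix_square_rows svd_sum_row norm_sum_orthonormal[OF v] power_mult_distrib)
  also have "\<dots> = (\<Sum>k<r. (c k)\<^sup>2 * (u k \<bullet> u k))"
    by (subst sum.swap) (simp add: inner_vec_def sum_distrib_left power2_eq_square)
  finally show ?thesis
    using u by (simp add: orthonormal_seqD)
qed

lemma op_norm_svd_sum_le:
  assumes u: "orthonormal_seq r u" and v: "orthonormal_seq r v"
    and B: "0 \<le> B" "\<And>k. k < r \<Longrightarrow> \<bar>c k\<bar> \<le> B"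
  shows "op_norm (svd_sum r u c v) \<le> B"
  unfolding op_norm_def
proof (rule onorm_bound[OF B(1)])
  fix x
  have sq: "(c k)\<^sup>2 \<le> B\<^sup>2" if "k < r" for k
    using power_mono[OF B(2)[OF that], of 2] by simp
  have "(norm (svd_sum r u c v *v x))\<^sup>2 = (\<Sum>k<r. (c k)\<^sup>2 * (v k \<bullet> x)\<^sup>2)"
    by (simp add: svd_sum_mult_vec norm_sum_orthonormal[OF u] power_mult_distrib)
  also have "\<dots> \<le> (\<Sum>k<r. B\<^sup>2 * (v k \<bullet> x)\<^sup>2)"
    using sq by (intro sum_mono mult_right_mono) auto
  also have "\<dots> \<le> (B * norm x)\<^sup>2"
    using bessel_inequality[OF v, of x]
    by (simp add: power_mult_distrib mult_left_mono flip: sum_distrib_left)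
  finally show "norm (svd_sum r u c v *v x) \<le> B * norm x"
    by (rule power2_le_imp_le) (use B(1) in simp)
qed

lemma norm_mult_vec_le_op_norm: "norm (A *v x) \<le> op_norm A * norm x"
  for A :: "real ^ 'n ^ 'm"
  unfolding op_norm_def by (rule onorm) (rule matrix_vector_mul_bounded_linear)

lemma abs_coeff_le_op_norm_svd_sum:
  assumes u: "orthonormal_seq r u" and v: "orthonormal_seq r v" and k: "k < r"
  shows "\<bar>c k\<bar> \<le> op_norm (svd_sum r u c v)"
proof -
  have "norm (u k) = 1" "norm (v k) = 1"
    using u v k by (auto simp: norm_eq_1 orthonormal_seqD)
  then show ?thesis
    using norm_mult_vec_le_op_norm[of "svd_sum r u c v" "v k"]
    by (simp add: svd_sum_mult_singular_vec[OF v k])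
qed

section \<open>Existence of a compact SVD by a variational argument\<close>

lemma linear_coeff_eq_0:
  fixes b c :: real
  assumes "\<And>t. 0 \<le> t * b + t\<^sup>2 * c"
  shows "b = 0"
proof (rule ccontr)
  assume b: "b \<noteq> 0"
  \<comment> \<open>At \<open>t = - e * b\<close> the quadratic equals
    \<open>e * (b\<^sup>2 * (e * c - 1))\<close>; this \<open>e\<close> is small enough to make it
    negative when \<open>b\<close> is nonzero.\<close>
  define e where "e = 1 / (\<bar>c\<bar> + 1)"
  have e: "0 < e" "e * \<bar>c\<bar> < 1"
    by (auto simp: e_def field_simps)
  have "e * (b\<^sup>2 * (e * c - 1)) = (- e * b) * b + (- e * b)\<^sup>2 * c"
    by (simp add: power2_eq_square algebra_simps)
  then have "0 \<le> e * (b\<^sup>2 * (e * c - 1))"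
    using assms[of "- e * b"] by simp
  then have "0 \<le> e * c - 1"
    using e(1) b by (simp add: zero_le_mult_iff)
  moreover have "e * c \<le> e * \<bar>c\<bar>"
    using e(1) by (intro mult_left_mono) auto
  ultimately show False
    using e(2) by linarith
qed

text \<open>Compactness gives a maximizer \<open>v\<close> of the norm of \<open>B *v x\<close> on
  the unit sphere. Stationarity makes it an eigenvector of the Gram matrix, and \<open>u\<close> is
  the normalized image of \<open>v\<close>.\<close>

lemma top_singular_pair:
  fixes B :: "real ^ 'n ^ 'm"
  assumes "B \<noteq> 0"
  obtains s u v where "0 < s" "norm u = 1" "norm v = 1" "B *v v = s *\<^sub>R u"
    "transpose B *v u = s *\<^sub>R v"
proof -
  obtain v where v: "norm v = 1" and max: "\<And>x. norm x = 1 \<Longrightarrow> norm (B *v x) \<le> norm (B *v v)"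
  proof -
    have "axis undefined 1 \<in> sphere (0 :: real ^ 'n) 1"
      by simp
    moreover have "continuous_on (sphere 0 1) (\<lambda>x. norm (B *v x))"
      by (intro continuous_intros matrix_vector_mult_linear_continuous_on)
    ultimately obtain v where "v \<in> sphere 0 1" "\<forall>x\<in>sphere 0 1. norm (B *v x) \<le> norm (B *v v)"
      using continuous_attains_sup[OF compact_sphere] by (metis empty_iff)
    then show ?thesis
      by (intro that[of v]) auto
  qed
  define s where "s = norm (B *v v)"
  have bound: "norm (B *v x) \<le> s * norm x" for x
  proof (cases "x = 0")
    case False
    then have "norm (B *v ((1 / norm x) *\<^sub>R x)) \<le> s"
      unfolding s_def by (intro max) simp
    then show ?thesis
      using False by (simp add: matrix_vector_mult_scaleR field_simps)
  qed simp
  have s: "0 < s"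
  proof (rule ccontr)
    assume "\<not> 0 < s"
    then have "s = 0" by (simp add: s_def)
    then have "B *v x = 0" for x
      using bound[of x] by simp
    then have "B = 0" by (simp add: matrix_eq)
    then show False using assms by simp
  qed
  \<comment> \<open>The quadratic form \<open>s\<^sup>2 |x|\<^sup>2 - |B x|\<^sup>2\<close> is nonnegative and vanishes at \<open>v\<close>, so its
    derivative there vanishes as well.\<close>
  have stat: "h \<bullet> (s\<^sup>2 *\<^sub>R v - transpose B *v (B *v v)) = 0" for h
  proof -
    have "0 \<le> t * (2 * (s\<^sup>2 * (v \<bullet> h) - (B *v v) \<bullet> (B *v h))) + t\<^sup>2 * (s\<^sup>2 * (h \<bullet> h) - (B *v h) \<bullet> (B *v h))"
      (is "0 \<le> ?q t") for t
    proof -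
      have "?q t = s\<^sup>2 * (norm (v + t *\<^sub>R h))\<^sup>2 - (norm (B *v (v + t *\<^sub>R h)))\<^sup>2
          - (s\<^sup>2 * (norm v)\<^sup>2 - (norm (B *v v))\<^sup>2)"
        unfolding power2_norm_eq_inner matrix_vector_right_distrib matrix_vector_mult_scaleR
        by (simp add: inner_add inner_commute power2_eq_square algebra_simps)
      also have "\<dots> = s\<^sup>2 * (norm (v + t *\<^sub>R h))\<^sup>2 - (norm (B *v (v + t *\<^sub>R h)))\<^sup>2"
        by (simp add: v s_def)
      finally have "?q t = s\<^sup>2 * (norm (v + t *\<^sub>R h))\<^sup>2 - (norm (B *v (v + t *\<^sub>R h)))\<^sup>2" .
      moreover have "(norm (B *v (v + t *\<^sub>R h)))\<^sup>2 \<le> s\<^sup>2 * (norm (v + t *\<^sub>R h))\<^sup>2"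
        using power_mono[OF bound norm_ge_zero] unfolding power_mult_distrib .
      ultimately show ?thesis by linarith
    qed
    then have "2 * (s\<^sup>2 * (v \<bullet> h) - (B *v v) \<bullet> (B *v h)) = 0"
      by (rule linear_coeff_eq_0)
    moreover have "(B *v v) \<bullet> (B *v h) = h \<bullet> (transpose B *v (B *v v))"
      by (metis dot_lmul_matrix inner_commute transpose_matrix_vector)
    ultimately show ?thesis
      by (simp add: inner_diff_right inner_commute)
  qed
  \<comment> \<open>Testing \<open>stat\<close> with the residual itself makes the squared norm of
    the residual zero.\<close>
  have BtB: "transpose B *v (B *v v) = s\<^sup>2 *\<^sub>R v"
    using stat[of "s\<^sup>2 *\<^sub>R v - transpose B *v (B *v v)"] by simp
  show ?thesis
  proof (rule that[OF s])
    show "norm v = 1" by (rule v)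
    show "norm ((1 / s) *\<^sub>R (B *v v)) = 1" using s by (simp add: s_def)
    show "B *v v = s *\<^sub>R ((1 / s) *\<^sub>R (B *v v))" using s by simp
    show "transpose B *v ((1 / s) *\<^sub>R (B *v v)) = s *\<^sub>R v"
      using s BtB unfolding matrix_vector_mult_scaleR by (simp add: power2_eq_square)
  qed
qed

text \<open>Greedy deflation: the remainder \<open>B\<close> is annihilated by the singular vectors found so far,
  so its own top singular pair extends the two orthonormal families.\<close>

lemma svd_deflation:
  fixes A :: "real ^ 'n ^ 'm"
  shows "\<exists>r u s v B. orthonormal_seq r u \<and> orthonormal_seq r v \<and> (\<forall>i<r. 0 < s i) \<and>
    A = svd_sum r u s v + B \<and> (\<forall>i<r. B *v v i = 0 \<and> transpose B *v u i = 0) \<and> (B = 0 \<or> r = k)"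
proof (induction k)
  case 0
  show ?case
    by (intro exI[of _ 0] exI[of _ A]) (auto simp: orthonormal_seq_def svd_sum_def)
next
  case (Suc k)
  then obtain r u s v B where IH: "orthonormal_seq r u" "orthonormal_seq r v" "\<forall>i<r. 0 < s i"
    "A = svd_sum r u s v + B" "\<forall>i<r. B *v v i = 0 \<and> transpose B *v u i = 0" "B = 0 \<or> r = k"
    by blast
  show ?case
  proof (cases "B = 0")
    case True
    then show ?thesis using IH by blast
  next
    case False
    then obtain t p q where tpq: "0 < t" "norm p = 1" "norm q = 1" "B *v q = t *\<^sub>R p"
      "transpose B *v p = t *\<^sub>R q"
      by (rule top_singular_pair)
    \<comment> \<open>Orthogonality to the earlier vectors is automatic: \<open>p\<close> lies in
      the range of \<open>B\<close>, and the transpose of \<open>B\<close> kills every earlier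
      \<open>u i\<close>.\<close>
    have p: "p \<bullet> u i = 0" if "i < r" for i
    proof -
      have "t * (p \<bullet> u i) = (B *v q) \<bullet> u i" by (simp add: tpq)
      also have "\<dots> = q \<bullet> (transpose B *v u i)"
        by (metis dot_lmul_matrix inner_commute transpose_matrix_vector)
      finally show ?thesis using IH(5) that tpq(1) by simp
    qed
    have q: "q \<bullet> v i = 0" if "i < r" for i
    proof -
      have "t * (q \<bullet> v i) = (transpose B *v p) \<bullet> v i" by (simp add: tpq(5) del: transpose_matrix_vector)
      also have "\<dots> = p \<bullet> (B *v v i)"
        by (metis dot_lmul_matrix transpose_matrix_vector)
      finally show ?thesis using IH(5) that tpq(1) by simp
    qed
    define u' where "u' = u(r := p)"
    define v' where "v' = v(r := q)"
    define s' where "s' = s(r := t)"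
    define B' where "B' = B - t *\<^sub>R outer p q"
    have pp: "p \<bullet> p = 1" and qq: "q \<bullet> q = 1" using tpq by (simp_all add: norm_eq_1)
    have B'v: "B' *v x = B *v x - (t * (q \<bullet> x)) *\<^sub>R p" for x
      by (simp add: B'_def matrix_vector_mult_diff_rdistrib outer_mult_vec
          scaleR_matrix_vector_assoc[symmetric])
    have "transpose (outer p q) = outer q p"
      by (simp add: transpose_def outer_def vec_eq_iff)
    then have "transpose B' = transpose B - t *\<^sub>R outer q p"
      by (simp add: B'_def transpose_def vec_eq_iff)
    then have B'u: "transpose B' *v x = transpose B *v x - (t * (p \<bullet> x)) *\<^sub>R q" for x
      by (simp add: matrix_vector_mult_diff_rdistrib outer_mult_vec
          scaleR_matrix_vector_assoc[symmetric] del: transpose_matrix_vector)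
    have "orthonormal_seq (Suc r) u'" "orthonormal_seq (Suc r) v'"
      using IH(1,2) p q pp qq by (auto simp: orthonormal_seq_def u'_def v'_def less_Suc_eq inner_commute)
    moreover have "\<forall>i<Suc r. 0 < s' i"
      using IH(3) tpq(1) by (auto simp: s'_def less_Suc_eq)
    moreover have "A = svd_sum (Suc r) u' s' v' + B'"
      by (simp add: IH(4) svd_sum_def u'_def v'_def s'_def B'_def)
    moreover have "\<forall>i<Suc r. B' *v v' i = 0 \<and> transpose B' *v u' i = 0"
      unfolding B'v B'u using IH(5) tpq p q pp qq
      by (auto simp: u'_def v'_def less_Suc_eq simp del: transpose_matrix_vector)
    moreover have "Suc r = Suc k" using False IH(6) by simp
    ultimately show ?thesis by blast
  qed
qed

lemma compact_svd_iff:
  "compact_svd A r u s v \<longleftrightarrow>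
    (\<forall>i<r. 0 < s i) \<and> orthonormal_seq r u \<and> orthonormal_seq r v \<and> A = svd_sum r u s v"
  by (simp add: compact_svd_def orthonormal_seq_def svd_sum_def)

text \<open>Asking the deflation for one pair more than the number of columns rules out the
  alternative \<open>r = k\<close>, so the remainder must be 0.\<close>

lemma compact_svd_exists: "\<exists>r u s v. compact_svd A r u s v"
  for A :: "real ^ 'n ^ 'm"
proof -
  obtain r u s v B where *: "orthonormal_seq r u" "orthonormal_seq r v" "\<forall>i<r. 0 < s i"
    "A = svd_sum r u s v + B" "B = 0 \<or> r = Suc CARD('n)"
    using svd_deflation[of A "Suc CARD('n)"] by blast
  have "r \<le> CARD('n)"
    using orthonormal_seq_length[OF *(2)] by simp
  then show ?thesis
    using * by (auto simp: compact_svd_iff)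
qed

text \<open>\<open>Orth\<close> picks a factorization with \<open>SOME\<close>. Handing out the very
  one behind that choice lets \<open>NS5\<close> be expanded later in the same singular
  vectors.\<close>

lemma Orth_svd:
  fixes A :: "real ^ 'n ^ 'm"
  obtains r u s v where "compact_svd A r u s v" "Orth A = svd_sum r u (\<lambda>_. 1) v"
proof (cases "A = 0")
  case True
  show ?thesis
    by (rule that[of 0]) (auto simp: True compact_svd_def Orth_def svd_sum_def)
next
  case False
  define P where "P Q \<longleftrightarrow> (\<exists>r u s v. compact_svd A r u s v \<and> Q = (\<Sum>i<r. outer (u i) (v i)))" for Q
  have "\<exists>Q. P Q"
    unfolding P_def using compact_svd_exists by blast
  then have "P (SOME Q. P Q)"
    by (rule someI_ex)
  then have "P (Orth A)"
    using False by (simp add: Orth_def P_def[abs_def])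
  then have "\<exists>r u s v. compact_svd A r u s v \<and> Orth A = (\<Sum>i<r. outer (u i) (v i))"
    by (simp add: P_def)
  then show ?thesis
    using that by (auto simp: svd_sum_def)
qed

section \<open>The Newton-Schulz polynomial on singular values\<close>

definition ns_scalar :: "real \<Rightarrow> real" where
  "ns_scalar x = (15/8 - 5/4 * x\<^sup>2 + 3/8 * x^4) * x"

text \<open>Positivity comes from completing the square in \<open>x\<^sup>2\<close>. The upper bound
  comes from the fixed point 1, where the first two derivatives vanish: 1 is a triple root of
  \<open>1 - ns_scalar x\<close>, and the cofactor is positive on (0, 1].\<close>

lemma ns_scalar_bounds:
  assumes "0 < x" "x \<le> 1"
  shows "0 < ns_scalar x" "ns_scalar x \<le> 1"
proof -
  have "15/8 - 5/4 * x\<^sup>2 + 3/8 * x^4 = 3/8 * (x\<^sup>2 - 5/3)\<^sup>2 + 5/6"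
    by (simp add: power2_eq_square power4_eq_xxxx algebra_simps)
  then have "0 < 15/8 - 5/4 * x\<^sup>2 + 3/8 * x^4"
    by (metis add_nonneg_pos divide_pos_pos mult_nonneg_nonneg zero_le_power2 zero_le_divide_iff zero_le_numeral zero_less_numeral)
  then show "0 < ns_scalar x"
    using assms by (simp add: ns_scalar_def)
  have "1 - ns_scalar x = (1 - x)^3 * (1 + 9/8 * x + 3/8 * x\<^sup>2)"
    by (simp add: ns_scalar_def power2_eq_square power4_eq_xxxx power3_eq_cube field_simps)
  also have "\<dots> \<ge> 0"
    using assms by (intro mult_nonneg_nonneg add_nonneg_nonneg) auto
  finally show "ns_scalar x \<le> 1" by simp
qed

text \<open>The Gram matrix and its square are diagonal in the family \<open>u\<close>, so an odd
  matrix polynomial changes the coefficients and keeps the singular vectors.\<close>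

lemma p_ns_mult_svd_sum:
  assumes u: "orthonormal_seq r u" and v: "orthonormal_seq r v"
  shows "p_ns (svd_sum r u c v ** transpose (svd_sum r u c v)) ** svd_sum r u c v =
    svd_sum r u (\<lambda>k. ns_scalar (c k)) v"
proof -
  let ?A = "svd_sum r u c v" and ?Z = "svd_sum r u (\<lambda>k. c k * c k) u"
  have Z: "?A ** transpose ?A = ?Z"
    by (simp add: transpose_svd_sum svd_sum_mult_svd_sum[OF v])
  have ZZ: "?Z ** ?Z = svd_sum r u (\<lambda>k. (c k * c k) * (c k * c k)) u"
    by (simp add: svd_sum_mult_svd_sum[OF u])
  have "p_ns ?Z ** ?A *v x = svd_sum r u (\<lambda>k. ns_scalar (c k)) v *v x" for x
  proof -
    have "p_ns ?Z ** ?A *v x = (15/8) *\<^sub>R (?A *v x) - (5/4) *\<^sub>R ((?Z ** ?A) *v x)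
        + (3/8) *\<^sub>R ((?Z ** ?Z ** ?A) *v x)"
      by (simp add: p_ns_def matrix_vector_mult_add_rdistrib matrix_vector_mult_diff_rdistrib
          scaleR_matrix_vector_assoc[symmetric] flip: matrix_vector_mul_assoc)
    also have "\<dots> = svd_sum r u (\<lambda>k. ns_scalar (c k)) v *v x"
      unfolding ZZ svd_sum_mult_svd_sum[OF u] svd_sum_mult_vec
      by (simp add: scaleR_sum_right ns_scalar_def power2_eq_square power4_eq_xxxx
          flip: sum.distrib sum_subtractf scaleR_left_diff_distrib scaleR_left_distrib)
        (auto intro!: sum.cong simp: algebra_simps)
    finally show ?thesis .
  qed
  then show ?thesis unfolding Z by (simp add: matrix_eq)
qed

lemma ns_iter_svd_sum:
  assumes u: "orthonormal_seq r u" and v: "orthonormal_seq r v"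
  shows "ns_iter j (svd_sum r u s v) =
    svd_sum r u (\<lambda>k. (ns_scalar ^^ j) (s k / max 1 (norm (svd_sum r u s v)))) v"
proof (induction j)
  case 0
  show ?case by (simp add: svd_sum_def scaleR_sum_right)
next
  case (Suc j)
  then show ?case by (simp add: p_ns_mult_svd_sum[OF u v])
qed

text \<open>It serves twice: the pre-scaling brings all singular values into (0, 1], and those of a
  row-normalized matrix are at most \<open>sqrt m\<close>.\<close>

lemma coeff_le_norm_svd_sum:
  assumes "orthonormal_seq r u" "orthonormal_seq r v" "k < r"
  shows "s k \<le> norm (svd_sum r u s v)"
proof -
  have "(s k)\<^sup>2 \<le> (\<Sum>k<r. (s k)\<^sup>2)"
    using assms(3) by (intro member_le_sum) auto
  then have "(s k)\<^sup>2 \<le> (norm (svd_sum r u s v))\<^sup>2"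
    by (simp only: norm_svd_sum[OF assms(1,2)])
  then show ?thesis
    by (rule power2_le_imp_le) simp
qed

lemma NS5_svd:
  fixes A :: "real ^ 'n ^ 'm"
  obtains r u s v c where "orthonormal_seq r u" "orthonormal_seq r v" "\<And>k. k < r \<Longrightarrow> 0 < s k"
    "A = svd_sum r u s v" "NS5 A = svd_sum r u c v" "\<And>k. k < r \<Longrightarrow> 0 < c k \<and> c k \<le> 1"
    "Orth A = svd_sum r u (\<lambda>_. 1) v"
proof -
  obtain r u s v where svd: "compact_svd A r u s v" and Orth: "Orth A = svd_sum r u (\<lambda>_. 1) v"
    by (rule Orth_svd)
  then have u: "orthonormal_seq r u" and v: "orthonormal_seq r v"
    and s: "\<And>k. k < r \<Longrightarrow> 0 < s k" and A: "A = svd_sum r u s v"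
    by (auto simp: compact_svd_iff)
  define c where "c = (\<lambda>k. (ns_scalar ^^ 5) (s k / max 1 (norm A)))"
  have "NS5 A = svd_sum r u c v"
    unfolding NS5_def c_def by (subst (1 2) A) (rule ns_iter_svd_sum[OF u v])
  moreover have "0 < c k \<and> c k \<le> 1" if k: "k < r" for k
  proof -
    have "0 < (ns_scalar ^^ j) x \<and> (ns_scalar ^^ j) x \<le> 1" if "0 < x" "x \<le> 1" for j x
      using that by (induction j) (auto intro: ns_scalar_bounds)
    moreover have "s k / max 1 (norm A) \<le> 1"
      using coeff_le_norm_svd_sum[OF u v k, of s] by (simp add: A divide_le_eq_1 less_max_iff_disj le_max_iff_disj)
    moreover have "0 < s k / max 1 (norm A)"
      using s[OF k] by (intro divide_pos_pos) auto
    ultimately show ?thesis unfolding c_def by blast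
  qed
  ultimately show ?thesis
    using that[OF u v s A _ _ Orth] by blast
qed

lemma norm_NS5_le: "norm (NS5 A) \<le> sqrt (real CARD('n))"
  for A :: "real ^ 'n ^ 'm"
proof -
  obtain r u v c where u: "orthonormal_seq r u" and v: "orthonormal_seq r v"
    and NS: "NS5 A = svd_sum r u c v" and c: "\<And>k. k < r \<Longrightarrow> 0 < c k \<and> c k \<le> 1"
    using NS5_svd[of A] by metis
  have "(norm (NS5 A))\<^sup>2 \<le> (\<Sum>k<r. 1)"
    unfolding NS norm_svd_sum[OF u v] using c by (intro sum_mono) (auto simp: power_le_one less_imp_le)
  also have "\<dots> \<le> real CARD('n)"
    using orthonormal_seq_length[OF v] by simp
  finally show ?thesis by (rule real_le_rsqrt)
qed

lemma op_norm_NS5_minus_Orth_less_1: "op_norm (NS5 A - Orth A) < 1"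
  for A :: "real ^ 'n ^ 'm"
proof -
  obtain r u v c where u: "orthonormal_seq r u" and v: "orthonormal_seq r v"
    and NS: "NS5 A = svd_sum r u c v" and c: "\<And>k. k < r \<Longrightarrow> 0 < c k \<and> c k \<le> 1"
    and Orth: "Orth A = svd_sum r u (\<lambda>_. 1) v"
    using NS5_svd[of A] by metis
  have diff: "NS5 A - Orth A = svd_sum r u (\<lambda>k. c k - 1) v"
    by (simp add: NS Orth svd_sum_def scaleR_left_diff_distrib sum_subtractf)
  \<comment> \<open>A maximum over finitely many values below 1 stays strictly below 1; the inserted
    0 covers the zero matrix, where \<open>r = 0\<close>.\<close>
  define B where "B = Max (insert 0 ((\<lambda>k. \<bar>c k - 1\<bar>) ` {..<r}))"
  have "op_norm (NS5 A - Orth A) \<le> B"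
    unfolding diff B_def by (rule op_norm_svd_sum_le[OF u v]) auto
  also have "B < 1"
    unfolding B_def using c by (subst Max_less_iff) auto
  finally show ?thesis .
qed

lemma op_norm_nonneg: "0 \<le> op_norm A"
  for A :: "real ^ 'n ^ 'm"
  unfolding op_norm_def by (rule onorm_pos_le) (rule matrix_vector_mul_bounded_linear)

text \<open>Each nonzero row of the normalized matrix has squared norm \<open>\<Sum> s\<^sub>k\<^sup>2 u\<^sub>k\<^sub>i\<^sup>2 = 1\<close>, and
  \<open>s\<^sub>k \<le> \<surd>m\<close>, so its inner product \<open>\<Sum> s\<^sub>k c\<^sub>k u\<^sub>k\<^sub>i\<^sup>2\<close> with the same row of the
  Newton-Schulz image is at least \<open>(1 - e) / \<surd>m\<close>.\<close>

lemma inner_NS5_row_normalize_ge: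
  fixes M :: "real ^ 'n ^ 'm"
  assumes e: "op_norm (NS5 (row_normalize M) - Orth (row_normalize M)) \<le> e" "e < 1"
  shows "(1 - e) / sqrt (real CARD('m)) * norm M \<le> M \<bullet> NS5 (row_normalize M)"
proof -
  let ?N = "row_normalize M" and ?m = "sqrt (real CARD('m))"
  obtain r u s v c where u: "orthonormal_seq r u" and v: "orthonormal_seq r v"
    and s: "\<And>k. k < r \<Longrightarrow> 0 < s k" and N: "?N = svd_sum r u s v" and NS: "NS5 ?N = svd_sum r u c v"
    and c: "\<And>k. k < r \<Longrightarrow> 0 < c k \<and> c k \<le> 1" and Orth: "Orth ?N = svd_sum r u (\<lambda>_. 1) v"
    using NS5_svd[of ?N] by metis
  have diff: "NS5 ?N - Orth ?N = svd_sum r u (\<lambda>k. c k - 1) v"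
    by (simp add: NS Orth svd_sum_def scaleR_left_diff_distrib sum_subtractf)
  have c_ge: "1 - e \<le> c k" if "k < r" for k
    using abs_coeff_le_op_norm_svd_sum[OF u v that, of "\<lambda>k. c k - 1"] e(1) unfolding diff by linarith
  have s_le: "s k \<le> ?m" if "k < r" for k
    using coeff_le_norm_svd_sum[OF u v that, of s] norm_row_normalize_le[of M] unfolding N by linarith
  have row: "(1 - e) / ?m * norm (M $ i) \<le> M $ i \<bullet> NS5 ?N $ i" for i
  proof (cases "M $ i = 0")
    case False
    have "norm (?N $ i) = 1"
      using False by (simp add: row_normalize_row)
    then have "1 = (\<Sum>k<r. (s k * u k $ i)\<^sup>2)"
      unfolding N svd_sum_row using norm_sum_orthonormal[OF v, of "\<lambda>k. s k * u k $ i"] by simp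
    then have "(1 - e) / ?m = (\<Sum>k<r. (1 - e) / ?m * (s k * u k $ i)\<^sup>2)"
      unfolding sum_distrib_left[symmetric] by simp
    also have "\<dots> \<le> (\<Sum>k<r. (s k * u k $ i) * (c k * u k $ i))"
    proof (rule sum_mono)
      fix k assume "k \<in> {..<r}"
      then have k: "k < r" by simp
      \<comment> \<open>One of the two factors \<open>s k\<close> is traded for
        \<open>sqrt m\<close>, and \<open>1 - e\<close> for \<open>c k\<close>; the other
        \<open>s k\<close> survives for the inner product.\<close>
      have "(1 - e) * (s k / ?m) \<le> c k * 1"
        using c_ge[OF k] s_le[OF k] s[OF k] e(2) c[OF k] by (intro mult_mono) auto
      then have "(1 - e) * (s k / ?m) * (s k * (u k $ i)\<^sup>2) \<le> c k * 1 * (s k * (u k $ i)\<^sup>2)"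
        using s[OF k] by (intro mult_right_mono) auto
      then show "(1 - e) / ?m * (s k * u k $ i)\<^sup>2 \<le> (s k * u k $ i) * (c k * u k $ i)"
        by (simp add: power2_eq_square mult_ac)
    qed
    also have "\<dots> = ?N $ i \<bullet> NS5 ?N $ i"
      unfolding NS unfolding N svd_sum_row inner_sum_left
      by (auto simp: inner_sum_orthonormal[OF v] intro!: sum.cong)
    finally have "(1 - e) / ?m * norm (M $ i) \<le> ?N $ i \<bullet> NS5 ?N $ i * norm (M $ i)"
      by (rule mult_right_mono) simp
    also have "\<dots> = M $ i \<bullet> NS5 ?N $ i"
      using False by (simp add: row_normalize_row)
    finally show ?thesis .
  qed simp
  \<comment> \<open>The Frobenius norm is at most the sum of the row norms, so the row estimates can
    simply be added.\<close>
  have "(1 - e) / ?m * norm M \<le> (1 - e) / ?m * (\<Sum>i\<in>UNIV. norm (M $ i))"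
    using e(2) by (intro mult_left_mono) (auto simp: norm_vec_def intro: L2_set_le_sum)
  also have "\<dots> \<le> (\<Sum>i\<in>UNIV. M $ i \<bullet> NS5 ?N $ i)"
    unfolding sum_distrib_left by (intro sum_mono row)
  also have "\<dots> = M \<bullet> NS5 ?N"
    by (simp add: inner_vec_def)
  finally show ?thesis .
qed

lemma continuous_on_ns_iter: "continuous_on UNIV (ns_iter k :: real ^ 'n ^ 'm \<Rightarrow> _)"
proof (induction k)
  case 0
  show ?case unfolding ns_iter.simps by (intro continuous_intros) auto
next
  case (Suc k)
  show ?case
    unfolding ns_iter.simps p_ns_def transpose_def matrix_matrix_mult_def mat_def
    by (intro continuous_intros Suc)
qed

lemma borel_measurable_NS5 [measurable]: "NS5 \<in> borel_measurable (borel :: (real ^ 'n ^ 'm) measure)"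
  unfolding NS5_def by (intro borel_measurable_continuous_onI continuous_on_ns_iter)

section \<open>Sums, descent and joint measurability\<close>

lemma powr_quarter_power4: "0 \<le> x \<Longrightarrow> (x powr (1/4)) ^ 4 = x"
  for x :: real
  by (cases "x = 0") (simp_all add: powr_power)

text \<open>Factor y^4 - z^4 = 1 for the two fourth roots and bound the cubic cofactor by 4 y^3. The
  right-hand side telescopes when the step sizes are summed.\<close>

lemma powr_neg_three_quarters_le:
  assumes "1 \<le> (x :: real)"
  shows "x powr (- 3/4) \<le> 4 * (x powr (1/4) - (x - 1) powr (1/4))"
proof -
  define y z where "y = x powr (1/4)" and "z = (x - 1) powr (1/4)"
  have y: "0 < y" "0 \<le> z" "z \<le> y"
    using assms by (auto simp: y_def z_def intro: powr_mono2)
  have "y ^ 4 = x" "z ^ 4 = x - 1"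
    unfolding y_def z_def using assms by (auto intro!: powr_quarter_power4)
  then have "1 = (y - z) * (y^3 + y\<^sup>2 * z + y * z\<^sup>2 + z^3)"
    by (simp add: power4_eq_xxxx power3_eq_cube power2_eq_square algebra_simps)
  also have "\<dots> \<le> (y - z) * (y^3 + y\<^sup>2 * y + y * y\<^sup>2 + y^3)"
    using y by (intro mult_left_mono add_mono power_mono order.refl) auto
  also have "\<dots> = 4 * (y - z) * y^3"
    by (simp add: power3_eq_cube power2_eq_square)
  finally have "1 / y^3 \<le> 4 * (y - z)"
    using y by (simp add: pos_divide_le_eq)
  moreover have "x powr (- 3/4) = 1 / y^3"
    using assms by (simp add: y_def powr_power powr_minus_divide)
  ultimately show ?thesis
    by (simp add: y_def z_def)
qed

lemma sum_inverse_le_ln: "1 \<le> n \<Longrightarrow> (\<Sum>t=1..n. 1 / real t) \<le> 1 + ln (real n)"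
proof -
  assume "1 \<le> n"
  then have "harm n - ln (real n) \<le> harm 1 - ln (real 1 :: real)"
    by (intro euler_mascheroni_sequence_decreasing) auto
  then show ?thesis
    by (simp add: harm_def field_simps)
qed

lemma sum_powr_neg_three_halves_le:
  assumes "1 \<le> n"
  shows "(\<Sum>t=1..n. real t powr (- 3/2)) \<le> 3"
proof -
  \<comment> \<open>The integral comparison in a form that supports induction, with equality at
    \<open>n = 1\<close>; the subtracted term absorbs the next summand.\<close>
  have "(\<Sum>t=1..n. real t powr (- 3/2)) \<le> 3 - 2 / sqrt (real n)"
    using assms
  proof (induction n rule: nat_induct_at_least)
    case base
    show ?case by simp
  next
    case (Suc n)
    define x y where "x = sqrt (real n)" and "y = sqrt (real (Suc n))"
    have xy: "0 < x" "x \<le> y" "y\<^sup>2 - x\<^sup>2 = 1" and y: "0 < y"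
      using Suc(1) by (auto simp: x_def y_def)
    have "x * y * (x + y) \<le> y * y * (y + y)"
      using xy y by (intro mult_mono add_mono) auto
    then have "x * y * (x + y) \<le> 2 * y^3"
      by (simp add: power3_eq_cube)
    then have "2 / (2 * y^3) \<le> 2 / (x * y * (x + y))"
      using xy(1) y by (intro divide_left_mono) auto
    then have "1 / y^3 \<le> 2 / (x * y * (x + y))"
      by simp
    also have "\<dots> = 2 * (y\<^sup>2 - x\<^sup>2) / (x * y * (x + y))"
      by (simp add: xy)
    also have "\<dots> = 2 / x - 2 / y"
      using xy(1) y by (simp add: divide_simps) (simp add: algebra_simps power2_eq_square)
    finally have "1 / y^3 \<le> 2 / x - 2 / y" .
    moreover have "real (Suc n) powr (- 3/2) = 1 / y^3"
      by (simp add: y_def powr_half_sqrt[symmetric] powr_power powr_minus_divide del: of_nat_Suc)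
    ultimately show ?case
      using Suc.IH by (simp add: x_def y_def)
  qed
  also have "\<dots> \<le> 3" by simp
  finally show ?thesis .
qed

text \<open>Convexity of the squared norm, with weights \<open>b\<close> and \<open>1 - b\<close> at
  the points \<open>x\<close> and \<open>(b / (1 - b)) *\<^sub>R y\<close>. The weight
  \<open>b\<close> of the first term is what makes the momentum recursion telescope.\<close>

lemma convex_norm_square:
  fixes x y :: "'a :: real_inner"
  assumes b: "0 \<le> b" "b < 1"
  shows "(norm (b *\<^sub>R (x + y)))\<^sup>2 \<le> b * (norm x)\<^sup>2 + b\<^sup>2 / (1 - b) * (norm y)\<^sup>2"
proof -
  have "b * (norm x)\<^sup>2 + b\<^sup>2 / (1 - b) * (norm y)\<^sup>2 - (norm (b *\<^sub>R (x + y)))\<^sup>2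
      = b * (1 - b) * (norm (x - (b / (1 - b)) *\<^sub>R y))\<^sup>2"
    using b unfolding power2_norm_eq_inner
    by (simp add: inner_add inner_diff inner_commute power2_eq_square divide_simps)
      (simp add: algebra_simps)
  also have "\<dots> \<ge> 0"
    using b by (intro mult_nonneg_nonneg) auto
  finally show ?thesis by simp
qed

text \<open>Restricted to the segment, \<open>f\<close> minus its linear part and minus the
  quadratic bound has a nonpositive derivative; comparing the endpoints is the claim.\<close>

lemma descent_lemma:
  fixes f :: "'a :: real_inner \<Rightarrow> real"
  assumes grad: "\<And>x. GDERIV f x :> g x"
    and smooth: "\<And>x y. norm (g y - g x) \<le> L * norm (y - x)"
  shows "f y \<le> f x + g x \<bullet> (y - x) + L / 2 * (norm (y - x))\<^sup>2"
proof -
  define d where "d = y - x"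
  define \<phi> where "\<phi> t = f (x + t *\<^sub>R d) - t * (g x \<bullet> d) - L * t\<^sup>2 / 2 * (norm d)\<^sup>2" for t
  have deriv: "(\<phi> has_real_derivative (g (x + t *\<^sub>R d) - g x) \<bullet> d - L * t * (norm d)\<^sup>2) (at t)" for t
  proof -
    have "((\<lambda>t. f (x + t *\<^sub>R d)) has_derivative (\<lambda>h. (h *\<^sub>R d) \<bullet> g (x + t *\<^sub>R d))) (at t)"
      using grad[of "x + t *\<^sub>R d", unfolded gderiv_def]
      by (intro has_derivative_compose[where f="\<lambda>t. x + t *\<^sub>R d" and g=f])
        (auto intro!: derivative_eq_intros)
    then have "((\<lambda>t. f (x + t *\<^sub>R d)) has_real_derivative g (x + t *\<^sub>R d) \<bullet> d) (at t)"
      by (simp add: has_field_derivative_def inner_commute mult.commute[of _ "_ \<bullet> _"])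
    then show ?thesis
      unfolding \<phi>_def
      by (auto intro!: derivative_eq_intros simp: inner_diff_left power2_eq_square)
  qed
  have "\<phi> 1 \<le> \<phi> 0"
  proof (rule DERIV_nonpos_imp_nonincreasing[of 0 1])
    fix t :: real assume t: "0 \<le> t" "t \<le> 1"
    have "(g (x + t *\<^sub>R d) - g x) \<bullet> d \<le> norm (g (x + t *\<^sub>R d) - g x) * norm d"
      by (rule norm_cauchy_schwarz)
    also have "\<dots> \<le> (L * norm ((x + t *\<^sub>R d) - x)) * norm d"
      by (intro mult_right_mono smooth) auto
    also have "\<dots> = L * t * (norm d)\<^sup>2"
      using t by (simp add: power2_eq_square)
    finally show "\<exists>z. (\<phi> has_real_derivative z) (at t) \<and> z \<le> 0"
      using deriv[of t] by (intro exI conjI) (assumption, simp)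
  qed simp
  then show ?thesis
    by (simp add: \<phi>_def d_def)
qed

text \<open>Round \<open>x\<close> down to a grid of mesh 1/(k+1). The grid is countable, so
  measurability in \<open>s\<close> for each fixed \<open>x\<close> suffices for the approximants,
  and continuity in \<open>x\<close> passes to the limit.\<close>

lemma borel_measurable_caratheodory:
  fixes f :: "'a :: euclidean_space \<Rightarrow> 's \<Rightarrow> 'b :: metric_space"
  assumes meas: "\<And>x. f x \<in> borel_measurable D"
    and cont: "\<And>s. s \<in> space D \<Longrightarrow> continuous_on UNIV (\<lambda>x. f x s)"
  shows "(\<lambda>(x, s). f x s) \<in> borel_measurable (borel \<Otimes>\<^sub>M D)"
proof (rule borel_measurable_LIMSEQ_metric)
  define r :: "nat \<Rightarrow> 'a \<Rightarrow> 'a"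
    where "r k x = (\<Sum>b\<in>Basis. (real_of_int \<lfloor>real (Suc k) * (x \<bullet> b)\<rfloor> / real (Suc k)) *\<^sub>R b)" for k x
  have [measurable]: "r k \<in> borel_measurable borel" for k
    unfolding r_def by measurable
  have "range (r k) \<subseteq> (\<lambda>c :: 'a \<Rightarrow> int. \<Sum>b\<in>Basis. (real_of_int (c b) / real (Suc k)) *\<^sub>R b)
      ` (Basis \<rightarrow>\<^sub>E UNIV)" for k
  proof (rule image_subsetI)
    fix x :: 'a
    show "r k x \<in> (\<lambda>c :: 'a \<Rightarrow> int. \<Sum>b\<in>Basis. (real_of_int (c b) / real (Suc k)) *\<^sub>R b)
      ` (Basis \<rightarrow>\<^sub>E UNIV)"
      by (rule image_eqI[of _ _ "\<lambda>b\<in>Basis. \<lfloor>real (Suc k) * (x \<bullet> b)\<rfloor>"]) (auto simp: r_def)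
  qed
  then have countable: "countable (range (r k))" for k
    by (rule countable_subset) (intro countable_image countable_PiE, auto)
  show "(\<lambda>(x, s). f (r k x) s) \<in> borel_measurable (borel \<Otimes>\<^sub>M D)" for k
  proof -
    have *: "(\<lambda>p. r k (fst p)) \<in> measurable (borel \<Otimes>\<^sub>M D) (count_space (range (r k)))"
      unfolding measurable_count_space_eq_countable[OF countable]
      by (auto intro!: measurable_sets[of _ "borel \<Otimes>\<^sub>M D" borel])
    show ?thesis
      using measurable_compose_countable'[OF _ * countable, of "\<lambda>x p. f x (snd p)" borel] meas
      by (simp add: case_prod_beta' measurable_compose[OF measurable_snd])
  qed
  show "(\<lambda>k. case p of (x, s) \<Rightarrow> f (r k x) s) \<longlonglongrightarrow> (case p of (x, s) \<Rightarrow> f x s)"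
    if "p \<in> space (borel \<Otimes>\<^sub>M D)" for p
  proof -
    obtain x s where p: "p = (x, s)" "s \<in> space D"
      using \<open>p \<in> space _\<close> by (auto simp: space_pair_measure)
    have "(\<lambda>k. real_of_int \<lfloor>real (Suc k) * c\<rfloor> / real (Suc k)) \<longlonglongrightarrow> c" for c :: real
      by real_asymp
    then have "(\<lambda>k. r k x) \<longlonglongrightarrow> (\<Sum>b\<in>Basis. (x \<bullet> b) *\<^sub>R b)"
      unfolding r_def by (intro tendsto_intros)
    then have "(\<lambda>k. r k x) \<longlonglongrightarrow> x"
      by (simp add: euclidean_representation)
    then show ?thesis
      using continuous_on_tendsto_compose[OF cont[OF p(2)]] by (simp add: p(1))
  qed
qed

text \<open>The stochastic gradient is specified only for each sample separately. Its coordinates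
  are limits of difference quotients of a jointly measurable function, hence jointly
  measurable.\<close>

lemma borel_measurable_gderiv:
  fixes f :: "'a :: euclidean_space \<Rightarrow> 's \<Rightarrow> real"
  assumes meas: "\<And>x. f x \<in> borel_measurable D"
    and grad: "\<And>x s. s \<in> space D \<Longrightarrow> GDERIV (\<lambda>y. f y s) x :> g x s"
  shows "(\<lambda>(x, s). g x s) \<in> borel_measurable (borel \<Otimes>\<^sub>M D)"
proof (subst borel_measurable_euclidean_space, rule ballI)
  fix b :: 'a assume "b \<in> Basis"
  have [measurable]: "(\<lambda>p. f (fst p) (snd p)) \<in> borel_measurable (borel \<Otimes>\<^sub>M D)"
  proof -
    have "continuous_on UNIV (\<lambda>x. f x s)" if "s \<in> space D" for s
      using grad[OF that, unfolded gderiv_def, THEN has_derivative_continuous]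
      by (simp add: continuous_on_eq_continuous_within)
    from borel_measurable_caratheodory[of f, OF meas this] show ?thesis
      by (simp add: case_prod_beta')
  qed
  show "(\<lambda>p. (case p of (x, s) \<Rightarrow> g x s) \<bullet> b) \<in> borel_measurable (borel \<Otimes>\<^sub>M D)"
  proof (rule borel_measurable_LIMSEQ_metric)
    fix k :: nat
    have "(\<lambda>p. (fst p + (1 / real (Suc k)) *\<^sub>R b, snd p)) \<in> measurable (borel \<Otimes>\<^sub>M D) (borel \<Otimes>\<^sub>M D)"
      by measurable
    from measurable_compose[OF this, of "\<lambda>p. f (fst p) (snd p)" borel]
    show "(\<lambda>p. (f (fst p + (1 / real (Suc k)) *\<^sub>R b) (snd p) - f (fst p) (snd p)) / (1 / real (Suc k)))
        \<in> borel_measurable (borel \<Otimes>\<^sub>M D)"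
      by (simp del: of_nat_Suc)
  next
    fix p :: "'a \<times> 's" assume "p \<in> space (borel \<Otimes>\<^sub>M D)"
    then obtain x s where p: "p = (x, s)" "s \<in> space D"
      by (auto simp: space_pair_measure)
    have "((\<lambda>t. f (x + t *\<^sub>R b) s) has_derivative (\<lambda>h. (h *\<^sub>R b) \<bullet> g x s)) (at 0)"
      using grad[OF p(2), of x, unfolded gderiv_def]
      by (intro has_derivative_compose[where f="\<lambda>t. x + t *\<^sub>R b" and g="\<lambda>y. f y s"])
        (auto intro!: derivative_eq_intros)
    then have "((\<lambda>t. f (x + t *\<^sub>R b) s) has_real_derivative g x s \<bullet> b) (at 0)"
      by (simp add: has_field_derivative_def inner_commute mult.commute[of _ "_ \<bullet> _"])
    then have lim: "((\<lambda>h. (f (x + h *\<^sub>R b) s - f x s) / h) \<longlongrightarrow> g x s \<bullet> b) (at 0)"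
      by (simp add: DERIV_def)
    have "filterlim (\<lambda>k. 1 / real (Suc k)) (at 0) sequentially"
      unfolding filterlim_at using LIMSEQ_inverse_real_of_nat by (simp add: divide_inverse)
    from filterlim_compose[OF lim this]
    show "(\<lambda>k. (f (fst p + (1 / real (Suc k)) *\<^sub>R b) (snd p) - f (fst p) (snd p)) / (1 / real (Suc k)))
        \<longlonglongrightarrow> (case p of (x, s) \<Rightarrow> g x s) \<bullet> b"
      by (simp add: p(1) del: of_nat_Suc)
  qed
qed

section \<open>Independence and the momentum recursion\<close>

text \<open>The cross term has mean 0 by unbiasedness. The result is a nonnegative integral because
  it serves as the inner integral in \<open>nn_integral_product_law\<close>.\<close>

lemma second_moment_affine_noise:
  fixes g :: "'s \<Rightarrow> 'a :: euclidean_space"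
  assumes D: "prob_space D" and unbiased: "has_bochner_integral D g b"
    and var_int: "integrable D (\<lambda>s. (norm (g s - b))\<^sup>2)"
    and var: "(\<integral>s. (norm (g s - b))\<^sup>2 \<partial>D) \<le> v"
  shows "(\<integral>\<^sup>+s. ennreal ((norm (A + c *\<^sub>R (b - g s)))\<^sup>2) \<partial>D) \<le> ennreal ((norm A)\<^sup>2 + c\<^sup>2 * v)"
proof -
  interpret D: prob_space D by (rule D)
  have g: "integrable D g" "(\<integral>s. g s \<partial>D) = b"
    using unbiased by (auto simp: has_bochner_integral_iff)
  have expand: "(norm (A + c *\<^sub>R (b - g s)))\<^sup>2 =
      (norm A)\<^sup>2 + 2 * c * (A \<bullet> (b - g s)) + c\<^sup>2 * (norm (g s - b))\<^sup>2" for s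
    unfolding power2_norm_eq_inner
    by (simp add: inner_add inner_diff inner_commute power2_eq_square algebra_simps)
  have mean: "(\<integral>s. A \<bullet> (b - g s) \<partial>D) = 0"
    using g by (simp add: D.prob_space)
  have int: "integrable D (\<lambda>s. A \<bullet> (b - g s))"
    using g by simp
  have total: "integrable D (\<lambda>s. (norm (A + c *\<^sub>R (b - g s)))\<^sup>2)"
    unfolding expand using int var_int by simp
  have "(\<integral>s. (norm (A + c *\<^sub>R (b - g s)))\<^sup>2 \<partial>D) = (norm A)\<^sup>2 + c\<^sup>2 * (\<integral>s. (norm (g s - b))\<^sup>2 \<partial>D)"
    unfolding expand using int var_int by (simp add: mean D.prob_space)
  also have "\<dots> \<le> (norm A)\<^sup>2 + c\<^sup>2 * v"
    using var by (simp add: mult_left_mono)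
  finally show ?thesis
    using total by (simp add: nn_integral_eq_integral ennreal_leI)
qed

text \<open>This plays the role of conditioning on the state: the sample is integrated out while
  \<open>Z\<close> stays fixed, for nonnegative integrands of possibly infinite integral.\<close>

lemma (in prob_space) nn_integral_product_law:
  assumes Z [measurable]: "Z \<in> measurable M S" and Y [measurable]: "Y \<in> measurable M N"
    and eq: "distr M (S \<Otimes>\<^sub>M N) (\<lambda>x. (Z x, Y x)) = distr M S Z \<Otimes>\<^sub>M distr M N Y"
    and h: "h \<in> borel_measurable (S \<Otimes>\<^sub>M N)"
  shows "(\<integral>\<^sup>+w. h (Z w, Y w) \<partial>M) = (\<integral>\<^sup>+w. (\<integral>\<^sup>+y. h (Z w, y) \<partial>distr M N Y) \<partial>M)"
proof -
  interpret NY: prob_space "distr M N Y" by (rule prob_space_distr[OF Y])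
  have h': "h \<in> borel_measurable (distr M S Z \<Otimes>\<^sub>M distr M N Y)"
    using h by (simp cong: measurable_cong_sets)
  have h'': "(\<lambda>z. \<integral>\<^sup>+y. h (z, y) \<partial>distr M N Y) \<in> borel_measurable S"
    using NY.borel_measurable_nn_integral_fst[of h S] h by (simp cong: measurable_cong_sets)
  have "(\<integral>\<^sup>+w. h (Z w, Y w) \<partial>M) = (\<integral>\<^sup>+p. h p \<partial>(distr M S Z \<Otimes>\<^sub>M distr M N Y))"
    unfolding eq[symmetric] using h by (subst nn_integral_distr) auto
  also have "\<dots> = (\<integral>\<^sup>+z. (\<integral>\<^sup>+y. h (z, y) \<partial>distr M N Y) \<partial>distr M S Z)"
    by (rule NY.nn_integral_fst[OF h', symmetric])
  also have "\<dots> = (\<integral>\<^sup>+w. (\<integral>\<^sup>+y. h (Z w, y) \<partial>distr M N Y) \<partial>M)"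
    using h'' by (subst nn_integral_distr) auto
  finally show ?thesis .
qed

text \<open>The state before step \<open>t\<close> is a function of the samples \<open>1, \<dots>, t - 1\<close> only.\<close>

lemma (in prob_space) recursive_state_product_law:
  fixes W :: "nat \<Rightarrow> 'a \<Rightarrow> 'z"
  assumes ind: "indep_vars (\<lambda>_. D) xi {1..}"
    and z: "z \<in> space N" and W_1: "\<And>w. w \<in> space M \<Longrightarrow> W 1 w = z"
    and \<Phi>: "\<And>t. t \<ge> 1 \<Longrightarrow> \<Phi> t \<in> measurable (N \<Otimes>\<^sub>M D) N"
    and W_Suc: "\<And>t w. t \<ge> 1 \<Longrightarrow> w \<in> space M \<Longrightarrow> W (Suc t) w = \<Phi> t (W t w, xi t w)"
    and t: "t \<ge> 1"
  shows "W t \<in> measurable M N"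
    and "distr M (N \<Otimes>\<^sub>M D) (\<lambda>w. (W t w, xi t w)) = distr M N (W t) \<Otimes>\<^sub>M distr M D (xi t)"
proof -
  \<comment> \<open>At \<open>t = 1\<close> the index set is empty and \<open>F\<close> is constant;
    each later step adds one coordinate.\<close>
  have "\<exists>F \<in> measurable (PiM {1..<t} (\<lambda>_. D)) N.
    \<forall>w\<in>space M. W t w = F (restrict (\<lambda>i. xi i w) {1..<t})"
    using t
  proof (induction t rule: nat_induct_at_least)
    case base
    show ?case
      by (rule bexI[of _ "\<lambda>_. z"]) (use z W_1 in auto)
  next
    case (Suc t)
    then obtain F where F[measurable]: "F \<in> measurable (PiM {1..<t} (\<lambda>_. D)) N"
      and WF: "\<forall>w\<in>space M. W t w = F (restrict (\<lambda>i. xi i w) {1..<t})"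
      by blast
    have [measurable]: "\<Phi> t \<in> measurable (N \<Otimes>\<^sub>M D) N"
      using \<Phi> Suc.hyps by blast
    have r[measurable]: "(\<lambda>x. restrict x {1..<t}) \<in>
        measurable (PiM {1..<Suc t} (\<lambda>_. D)) (PiM {1..<t} (\<lambda>_. D))"
      by (rule measurable_restrict_subset) auto
    have p[measurable]: "(\<lambda>x. x t) \<in> measurable (PiM {1..<Suc t} (\<lambda>_. D)) D"
      by (rule measurable_component_singleton) (use Suc.hyps in auto)
    show ?case
    proof (rule bexI[of _ "\<lambda>x. \<Phi> t (F (restrict x {1..<t}), x t)"])
      have "restrict (restrict (\<lambda>i. xi i w) {1..<Suc t}) {1..<t} = restrict (\<lambda>i. xi i w) {1..<t}" for w
        by (auto simp: restrict_def fun_eq_iff)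
      then show "\<forall>w\<in>space M. W (Suc t) w =
          \<Phi> t (F (restrict (restrict (\<lambda>i. xi i w) {1..<Suc t}) {1..<t}), restrict (\<lambda>i. xi i w) {1..<Suc t} t)"
        using WF W_Suc Suc.hyps by simp
    qed measurable
  qed
  then obtain F where F[measurable]: "F \<in> measurable (PiM {1..<t} (\<lambda>_. D)) N"
    and WF: "\<And>w. w \<in> space M \<Longrightarrow> W t w = F (restrict (\<lambda>i. xi i w) {1..<t})"
    by blast
  let ?past = "\<lambda>w. restrict (\<lambda>i. xi i w) {1..<t}" and ?now = "\<lambda>w. restrict (\<lambda>i. xi i w) {t}"
  let ?A = "PiM {1..<t} (\<lambda>_. D)" and ?B = "PiM {t} (\<lambda>_. D)"
  have "indep_var ?A ?past ?B ?now"
    by (rule indep_var_restrict[OF ind]) (use t in auto)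
  then have past[measurable]: "?past \<in> measurable M ?A" and now[measurable]: "?now \<in> measurable M ?B"
    and eq: "distr M ?A ?past \<Otimes>\<^sub>M distr M ?B ?now = distr M (?A \<Otimes>\<^sub>M ?B) (\<lambda>w. (?past w, ?now w))"
    unfolding indep_var_distribution_eq by auto
  have p[measurable]: "(\<lambda>x. x t) \<in> measurable ?B D"
    by (rule measurable_component_singleton) simp
  have "(\<lambda>w. F (?past w)) \<in> measurable M N"
    by measurable
  then show "W t \<in> measurable M N"
    by (subst measurable_cong[OF WF])
  have WF': "distr M N (W t) = distr (distr M ?A ?past) N F"
    unfolding distr_distr[OF F past] comp_def by (intro distr_cong refl WF)
  have now': "distr M D (xi t) = distr (distr M ?B ?now) D (\<lambda>x. x t)"
    unfolding distr_distr[OF p now] comp_def by (intro distr_cong) simp_all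
  have "prob_space (distr (distr M ?B ?now) D (\<lambda>x. x t))"
    by (intro prob_space.prob_space_distr[OF prob_space_distr[OF now]])
      (simp add: measurable_distr_eq1 p)
  then interpret N: prob_space "distr (distr M ?B ?now) D (\<lambda>x. x t)" .
  \<comment> \<open>The product law of the two index blocks is pushed forward through
    \<open>F\<close> on the past and the coordinate projection on the present.\<close>
  have "distr M N (W t) \<Otimes>\<^sub>M distr M D (xi t) =
      distr (distr M ?A ?past \<Otimes>\<^sub>M distr M ?B ?now) (N \<Otimes>\<^sub>M D) (\<lambda>(x, y). (F x, y t))"
    unfolding WF' now'
    by (intro pair_measure_distr N.sigma_finite_measure_axioms) (simp_all only: measurable_distr_eq1 F p)
  also have "\<dots> = distr M (N \<Otimes>\<^sub>M D) ((\<lambda>(x, y). (F x, y t)) \<circ> (\<lambda>w. (?past w, ?now w)))"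
    unfolding eq by (rule distr_distr) measurable
  also have "\<dots> = distr M (N \<Otimes>\<^sub>M D) (\<lambda>w. (W t w, xi t w))"
    using WF by (intro distr_cong) auto
  finally show "distr M (N \<Otimes>\<^sub>M D) (\<lambda>w. (W t w, xi t w)) = distr M N (W t) \<Otimes>\<^sub>M distr M D (xi t)"
    by (rule sym)
qed

text \<open>Rearranged, the recursion bounds \<open>real (Suc t) powr (- 1/2) * v t\<close> by a
  telescoping difference plus \<open>C / real (Suc t)\<close>. The factor 2 pays for moving the
  weight from \<open>Suc t\<close> to \<open>t\<close>.\<close>

lemma momentum_recursion_sum:
  fixes v :: "nat \<Rightarrow> real"
  assumes v: "\<And>t. 1 \<le> t \<Longrightarrow> 0 \<le> v t" and v1: "v 1 \<le> s"
    and rec: "\<And>t. 1 \<le> t \<Longrightarrow> v (Suc t) \<le> (1 - real (Suc t) powr (- 1/2)) * v t + C / real (Suc t)"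
    and C: "0 \<le> C" and T: "1 \<le> T"
  shows "(\<Sum>t=1..T. real t powr (- 1/2) * v t) \<le> 2 * (s + C * (\<Sum>t=1..T. 1 / real t))"
proof -
  have tele: "(\<Sum>t=1..T. real (Suc t) powr (- 1/2) * v t) + v (Suc T)
      \<le> s + C * (\<Sum>t=1..T. 1 / real (Suc t))" for T
  proof (induction T)
    case 0
    show ?case using v1 by simp
  next
    case (Suc T)
    have "v (Suc (Suc T)) \<le> (1 - real (Suc (Suc T)) powr (- 1/2)) * v (Suc T) + C / real (Suc (Suc T))"
      by (rule rec) simp
    then show ?case
      using Suc.IH by (simp add: algebra_simps)
  qed
  have "real t powr (- 1/2) \<le> 2 * real (Suc t) powr (- 1/2)" if "1 \<le> t" for t
  proof -
    have "sqrt (real (Suc t)) \<le> sqrt (4 * real t)"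
      using that by (intro real_sqrt_le_mono) auto
    then have "sqrt (real (Suc t)) \<le> 2 * sqrt (real t)"
      by (simp add: real_sqrt_mult)
    then show ?thesis
      using that by (simp add: powr_minus_divide powr_half_sqrt field_simps del: of_nat_Suc)
  qed
  then have "(\<Sum>t=1..T. real t powr (- 1/2) * v t) \<le> (\<Sum>t=1..T. 2 * real (Suc t) powr (- 1/2) * v t)"
    using v by (intro sum_mono mult_right_mono) auto
  also have "\<dots> = 2 * (\<Sum>t=1..T. real (Suc t) powr (- 1/2) * v t)"
    by (simp add: sum_distrib_left mult.assoc)
  also have "\<dots> \<le> 2 * (s + C * (\<Sum>t=1..T. 1 / real (Suc t)))"
    using tele[of T] v[of "Suc T"] by simp
  also have "\<dots> \<le> 2 * (s + C * (\<Sum>t=1..T. 1 / real t))"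
    using C by (intro mult_left_mono add_left_mono sum_mono divide_left_mono) auto
  finally show ?thesis .
qed

section \<open>Descent with momentum\<close>

text \<open>The matrix structure enters only through the bound \<open>B\<close> on the direction
  \<open>U\<close> and, later, through the alignment hypothesis. The condition
  \<open>rho \<le> 4 * (a * B)\<close> keeps the decay factor in [0, 1].\<close>

locale momentum_method = prob_space P
  for P :: "'w measure" +
  fixes D :: "'s measure"
    and f :: "'a :: euclidean_space \<Rightarrow> real" and gradf :: "'a \<Rightarrow> 'a"
    and gradfs :: "'a \<Rightarrow> 's \<Rightarrow> 'a"
    and xi :: "nat \<Rightarrow> 'w \<Rightarrow> 's" and X M :: "nat \<Rightarrow> 'w \<Rightarrow> 'a" and U :: "'a \<Rightarrow> 'a"
    and X1 :: 'a and lam :: "nat \<Rightarrow> real" and a B rho L sig :: real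
  assumes D: "prob_space D"
    and gradf: "\<And>Y. GDERIV f Y :> gradf Y"
    and meas_gradfs: "(\<lambda>(x, s). gradfs x s) \<in> borel_measurable (borel \<Otimes>\<^sub>M D)"
    and L: "0 < L"
    and smooth: "\<And>Y Z. norm (gradf Z - gradf Y) \<le> L * norm (Z - Y)"
    and unbiased: "\<And>Y. has_bochner_integral D (gradfs Y) (gradf Y)"
    and variance_integrable: "\<And>Y. integrable D (\<lambda>s. (norm (gradfs Y s - gradf Y))\<^sup>2)"
    and variance: "\<And>Y. (\<integral>s. (norm (gradfs Y s - gradf Y))\<^sup>2 \<partial>D) \<le> sig\<^sup>2"
    and indep: "indep_vars (\<lambda>_. D) xi {1..}"
    and law: "\<And>t. 1 \<le> t \<Longrightarrow> distr P D (xi t) = D"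
    and M_0: "\<And>w. w \<in> space P \<Longrightarrow> M 0 w = 0"
    and X_1: "\<And>w. w \<in> space P \<Longrightarrow> X 1 w = X1"
    and M_t: "\<And>t w. 1 \<le> t \<Longrightarrow> w \<in> space P \<Longrightarrow>
      M t w = (1 - real t powr (- 1/2)) *\<^sub>R M (t - 1) w + real t powr (- 1/2) *\<^sub>R gradfs (X t w) (xi t w)"
    and X_t: "\<And>t w. 1 \<le> t \<Longrightarrow> w \<in> space P \<Longrightarrow>
      X (Suc t) w = (1 - lam t * real t powr (- 3/4)) *\<^sub>R X t w - (a * real t powr (- 3/4)) *\<^sub>R U (M t w)"
    and meas_U: "U \<in> borel_measurable borel"
    and norm_U: "\<And>x. norm (U x) \<le> B"
    and a: "0 < a" and B: "0 < B" and rho: "0 \<le> rho" "rho \<le> 4 * (a * B)"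
    and lam: "\<And>t. 1 \<le> t \<Longrightarrow>
      0 \<le> lam t \<and> lam t \<le> rho / (norm X1 + 4 * (a * B)) * real t powr (- 1/4)"
begin

text \<open>The step length divided by the step size: \<open>a * B\<close> is due to the direction,
  \<open>rho\<close> to the weight decay.\<close>

definition R :: real where "R = a * B + rho"

definition err :: "nat \<Rightarrow> 'w \<Rightarrow> 'a" where "err t w = gradf (X t w) - M t w"

lemma aB_pos: "0 < a * B"
  using a B by simp

lemma lam_eta:
  assumes "1 \<le> t"
  shows "0 \<le> lam t * real t powr (- 3/4)" "lam t * real t powr (- 3/4) \<le> 1"
proof -
  show "0 \<le> lam t * real t powr (- 3/4)"
    using lam[OF assms] by simp
  have p: "real t powr (- 1/4) \<le> 1" "real t powr (- 3/4) \<le> 1"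
    using assms powr_mono[of "- 1/4" 0 "real t"] powr_mono[of "- 3/4" 0 "real t"] by auto
  have S: "0 < norm X1 + 4 * (a * B)"
    using aB_pos by (intro add_nonneg_pos) auto
  have "rho / (norm X1 + 4 * (a * B)) \<le> 1"
    unfolding divide_le_eq_1_pos[OF S] using rho norm_ge_zero[of X1] by linarith
  then have "rho / (norm X1 + 4 * (a * B)) * real t powr (- 1/4) \<le> 1"
    using p(1) rho aB_pos by (intro mult_le_one) auto
  then have "lam t \<le> 1"
    using lam[OF assms] by linarith
  then show "lam t * real t powr (- 3/4) \<le> 1"
    using p(2) lam[OF assms] by (intro mult_le_one) auto
qed

text \<open>The decay contracts, so only the directions can increase the norm, and their step sizes
  telescope to 4 (t-1)^(1/4). The bound is deterministic, which later also gives
  integrability.\<close>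

lemma norm_X_le:
  assumes "1 \<le> t" "w \<in> space P"
  shows "norm (X t w) \<le> norm X1 + 4 * (a * B) * (real t - 1) powr (1/4)"
  using assms(1)
proof (induction t rule: nat_induct_at_least)
  case base
  show ?case using X_1[OF assms(2)] by simp
next
  case (Suc t)
  let ?h = "real t powr (- 3/4)"
  have "norm (X (Suc t) w) \<le> norm ((1 - lam t * ?h) *\<^sub>R X t w) + norm ((a * ?h) *\<^sub>R U (M t w))"
    unfolding X_t[OF Suc(1) assms(2)] by (rule norm_triangle_ineq4)
  also have "norm ((1 - lam t * ?h) *\<^sub>R X t w) \<le> norm (X t w)"
    using lam_eta[OF Suc(1)] by (simp add: mult_left_le_one_le)
  also have "norm ((a * ?h) *\<^sub>R U (M t w)) \<le> a * ?h * B"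
    using a norm_U[of "M t w"] by (simp add: abs_mult mult_left_mono)
  also have "a * ?h * B \<le> a * (4 * (real t powr (1/4) - (real t - 1) powr (1/4))) * B"
    using a B powr_neg_three_quarters_le[of "real t"] Suc(1)
    by (intro mult_right_mono mult_left_mono) auto
  finally show ?case
    using Suc.IH by (simp add: algebra_simps)
qed

text \<open>The growth t^(1/4) of the iterates meets the decay t^(-1/4) of \<open>lam\<close>; the
  denominator in the condition on \<open>lam\<close> is chosen to cancel the remaining
  factor.\<close>

lemma lam_norm_X_le:
  assumes "1 \<le> t" "w \<in> space P"
  shows "lam t * norm (X t w) \<le> rho"
proof -
  let ?q = "real t powr (1/4)" and ?S = "norm X1 + 4 * (a * B)"
  have S: "0 < ?S" using aB_pos norm_ge_zero[of X1] by (intro add_nonneg_pos) auto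
  have q: "1 \<le> ?q" using assms(1) by (simp add: ge_one_powr_ge_zero)
  have "norm (X t w) \<le> norm X1 * 1 + 4 * (a * B) * (real t - 1) powr (1/4)"
    using norm_X_le[OF assms] by simp
  also have "\<dots> \<le> norm X1 * ?q + 4 * (a * B) * ?q"
    using q aB_pos assms(1) by (intro add_mono mult_left_mono powr_mono2) auto
  also have "\<dots> = ?S * ?q" by (simp add: algebra_simps)
  finally have X: "norm (X t w) \<le> ?S * ?q" .
  have "lam t * norm (X t w) \<le> (rho / ?S * real t powr (- 1/4)) * (?S * ?q)"
    using lam[OF assms(1)] X rho S by (intro mult_mono) auto
  also have "\<dots> = rho * (real t powr (- 1/4) * ?q)"
    using S by simp
  also have "real t powr (- 1/4) * ?q = 1"
    using assms(1) by (simp flip: powr_add)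
  finally show ?thesis by simp
qed

lemma step_le:
  assumes "1 \<le> t" "w \<in> space P"
  shows "norm (X (Suc t) w - X t w) \<le> real t powr (- 3/4) * R"
proof -
  let ?h = "real t powr (- 3/4)"
  have "X (Suc t) w - X t w = - (?h *\<^sub>R (lam t *\<^sub>R X t w + a *\<^sub>R U (M t w)))"
    unfolding X_t[OF assms] by (simp add: algebra_simps)
  then have "norm (X (Suc t) w - X t w) = ?h * norm (lam t *\<^sub>R X t w + a *\<^sub>R U (M t w))"
    by simp
  also have "norm (lam t *\<^sub>R X t w + a *\<^sub>R U (M t w)) \<le> lam t * norm (X t w) + a * norm (U (M t w))"
    using norm_triangle_ineq[of "lam t *\<^sub>R X t w" "a *\<^sub>R U (M t w)"] lam[OF assms(1)] a by simp
  also have "\<dots> \<le> R"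
    using lam_norm_X_le[OF assms] mult_left_mono[OF norm_U[of "M t w"] less_imp_le[OF a]]
    by (simp add: R_def)
  finally show ?thesis by (simp add: mult_left_mono)
qed

lemma borel_measurable_gradf [measurable]: "gradf \<in> borel_measurable borel"
proof (rule borel_measurable_continuous_onI)
  have "L-lipschitz_on UNIV gradf"
    using L smooth by (auto simp: lipschitz_on_def dist_norm)
  then show "continuous_on UNIV gradf"
    by (rule lipschitz_on_continuous_on)
qed

definition next_M :: "nat \<Rightarrow> ('a \<times> 'a) \<times> 's \<Rightarrow> 'a" where
  "next_M t p = (1 - real t powr (- 1/2)) *\<^sub>R snd (fst p)
     + real t powr (- 1/2) *\<^sub>R gradfs (fst (fst p)) (snd p)"

lemma next_M_measurable [measurable]:
  "next_M t \<in> borel_measurable ((borel \<Otimes>\<^sub>M borel) \<Otimes>\<^sub>M D)"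
proof -
  have [measurable]: "(\<lambda>p :: ('a \<times> 'a) \<times> 's. gradfs (fst (fst p)) (snd p))
      \<in> borel_measurable ((borel \<Otimes>\<^sub>M borel) \<Otimes>\<^sub>M D)"
    using measurable_compose[OF _ meas_gradfs, of "\<lambda>p :: ('a \<times> 'a) \<times> 's. (fst (fst p), snd p)"
        "(borel \<Otimes>\<^sub>M borel) \<Otimes>\<^sub>M D"]
    by simp
  show ?thesis unfolding next_M_def by measurable
qed

text \<open>The momentum lags by one index: \<open>M t\<close> already contains sample
  \<open>t\<close>, so the state independent of \<open>xi t\<close> is the pair of
  \<open>X t\<close> and \<open>M (t - 1)\<close>.\<close>

lemma
  assumes "1 \<le> t"
  shows state_measurable: "(\<lambda>w. (X t w, M (t - 1) w)) \<in> measurable P (borel \<Otimes>\<^sub>M borel)"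
    and state_product_law: "distr P ((borel \<Otimes>\<^sub>M borel) \<Otimes>\<^sub>M D) (\<lambda>w. ((X t w, M (t - 1) w), xi t w)) =
      distr P (borel \<Otimes>\<^sub>M borel) (\<lambda>w. (X t w, M (t - 1) w)) \<Otimes>\<^sub>M distr P D (xi t)"
proof -
  define \<Phi> where "\<Phi> t p = ((1 - lam t * real t powr (- 3/4)) *\<^sub>R fst (fst p)
      - (a * real t powr (- 3/4)) *\<^sub>R U (next_M t p), next_M t p)" for t p
  have \<Phi>: "\<Phi> t \<in> measurable ((borel \<Otimes>\<^sub>M borel) \<Otimes>\<^sub>M D) (borel \<Otimes>\<^sub>M borel)" for t
    unfolding \<Phi>_def[abs_def] using meas_U by measurable
  have z: "(X1, 0) \<in> space (borel \<Otimes>\<^sub>M borel)"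
    by (simp add: space_pair_measure)
  have W_1: "(X 1 w, M (1 - 1) w) = (X1, 0)" if "w \<in> space P" for w
    using X_1 M_0 that by simp
  have W_Suc: "(X (Suc t) w, M (Suc t - 1) w) = \<Phi> t ((X t w, M (t - 1) w), xi t w)"
    if "1 \<le> t" "w \<in> space P" for t w
    using X_t[OF that] M_t[OF that] by (simp add: \<Phi>_def next_M_def)
  note law = recursive_state_product_law[where W = "\<lambda>t w. (X t w, M (t - 1) w)" and \<Phi> = \<Phi>,
      OF indep z W_1 \<Phi> W_Suc assms]
  show "(\<lambda>w. (X t w, M (t - 1) w)) \<in> measurable P (borel \<Otimes>\<^sub>M borel)"
    using law(1) by simp
  show "distr P ((borel \<Otimes>\<^sub>M borel) \<Otimes>\<^sub>M D) (\<lambda>w. ((X t w, M (t - 1) w), xi t w)) =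
      distr P (borel \<Otimes>\<^sub>M borel) (\<lambda>w. (X t w, M (t - 1) w)) \<Otimes>\<^sub>M distr P D (xi t)"
    using law(2) by simp
qed

lemma xi_measurable: "1 \<le> t \<Longrightarrow> xi t \<in> measurable P D"
  using indep by (auto simp: indep_vars_def)

lemma X_measurable: "1 \<le> t \<Longrightarrow> X t \<in> borel_measurable P"
  using measurable_fst'[OF state_measurable[of t]] by simp

lemma M_measurable: "M t \<in> borel_measurable P"
  using measurable_snd'[OF state_measurable[of "Suc t"]] by simp

lemma err_measurable: "1 \<le> t \<Longrightarrow> err t \<in> borel_measurable P"
  unfolding err_def[abs_def] using X_measurable[of t] M_measurable[of t] by measurable

text \<open>The error splits into a part fixed by the state and the gradient noise weighted by
  t^(-1/2), whose square is the 1/t in front of the variance.\<close>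

lemma error_second_moment:
  assumes "1 \<le> t"
  shows "(\<integral>\<^sup>+w. ennreal ((norm (err t w))\<^sup>2) \<partial>P) \<le>
    (\<integral>\<^sup>+w. ennreal ((norm ((1 - real t powr (- 1/2)) *\<^sub>R (gradf (X t w) - M (t - 1) w)))\<^sup>2
      + sig\<^sup>2 / real t) \<partial>P)"
proof -
  let ?q = "real t powr (- 1/2)"
  have q2: "?q\<^sup>2 = 1 / real t"
    using assms by (simp add: powr_power powr_neg_one)
  define A where "A z = (1 - ?q) *\<^sub>R (gradf (fst z) - snd z)" for z :: "'a \<times> 'a"
  define h where "h p = ennreal ((norm (A (fst p) + ?q *\<^sub>R
    (gradf (fst (fst p)) - gradfs (fst (fst p)) (snd p))))\<^sup>2)" for p :: "('a \<times> 'a) \<times> 's"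
  have [measurable]: "(\<lambda>p :: ('a \<times> 'a) \<times> 's. gradfs (fst (fst p)) (snd p))
      \<in> borel_measurable ((borel \<Otimes>\<^sub>M borel) \<Otimes>\<^sub>M D)"
    using measurable_compose[OF _ meas_gradfs, of "\<lambda>p :: ('a \<times> 'a) \<times> 's. (fst (fst p), snd p)"
        "(borel \<Otimes>\<^sub>M borel) \<Otimes>\<^sub>M D"]
    by simp
  have h: "h \<in> borel_measurable ((borel \<Otimes>\<^sub>M borel) \<Otimes>\<^sub>M D)"
    unfolding h_def[abs_def] A_def by measurable
  have "(\<integral>\<^sup>+w. ennreal ((norm (err t w))\<^sup>2) \<partial>P) = (\<integral>\<^sup>+w. h ((X t w, M (t - 1) w), xi t w) \<partial>P)"
  proof (rule nn_integral_cong)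
    fix w assume "w \<in> space P"
    then have "err t w = A (X t w, M (t - 1) w) + ?q *\<^sub>R (gradf (X t w) - gradfs (X t w) (xi t w))"
      using M_t[OF assms] by (simp add: err_def A_def algebra_simps)
    then show "ennreal ((norm (err t w))\<^sup>2) = h ((X t w, M (t - 1) w), xi t w)"
      by (simp add: h_def)
  qed
  also have "\<dots> = (\<integral>\<^sup>+w. (\<integral>\<^sup>+s. h ((X t w, M (t - 1) w), s) \<partial>distr P D (xi t)) \<partial>P)"
    by (rule nn_integral_product_law[OF state_measurable[OF assms] xi_measurable[OF assms]
          state_product_law[OF assms] h])
  also have "\<dots> \<le> (\<integral>\<^sup>+w. ennreal ((norm (A (X t w, M (t - 1) w)))\<^sup>2 + ?q\<^sup>2 * sig\<^sup>2) \<partial>P)"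
    unfolding law[OF assms] h_def fst_conv snd_conv
    by (intro nn_integral_mono second_moment_affine_noise D unbiased variance_integrable variance)
  finally show ?thesis
    unfolding A_def q2 fst_conv snd_conv by simp
qed

definition mean_err :: "nat \<Rightarrow> real" where "mean_err t = (\<integral>w. (norm (err t w))\<^sup>2 \<partial>P)"

lemma mean_err_nonneg: "0 \<le> mean_err t"
  by (simp add: mean_err_def)

text \<open>A Bochner integral defaults to 0 without integrability, so integrability and the bound
  on \<open>mean_err\<close> are extracted together from the nonnegative integral.\<close>

lemma error_integrable:
  assumes "1 \<le> t" "integrable P g" "\<And>w. w \<in> space P \<Longrightarrow> 0 \<le> g w"
    "\<And>w. w \<in> space P \<Longrightarrow>
      (norm ((1 - real t powr (- 1/2)) *\<^sub>R (gradf (X t w) - M (t - 1) w)))\<^sup>2 + sig\<^sup>2 / real t \<le> g w"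
  shows "integrable P (\<lambda>w. (norm (err t w))\<^sup>2) \<and> mean_err t \<le> (\<integral>w. g w \<partial>P)"
proof -
  have meas: "(\<lambda>w. (norm (err t w))\<^sup>2) \<in> borel_measurable P"
    using err_measurable[OF assms(1)] by measurable
  have "(\<integral>\<^sup>+w. ennreal ((norm (err t w))\<^sup>2) \<partial>P) \<le> (\<integral>\<^sup>+w. ennreal (g w) \<partial>P)"
    by (rule order_trans[OF error_second_moment[OF assms(1)]])
      (intro nn_integral_mono ennreal_leI assms(4))
  also have "\<dots> = ennreal (\<integral>w. g w \<partial>P)"
    using assms(2,3) by (intro nn_integral_eq_integral) auto
  finally have le: "(\<integral>\<^sup>+w. ennreal ((norm (err t w))\<^sup>2) \<partial>P) \<le> ennreal (\<integral>w. g w \<partial>P)" .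
  have int: "integrable P (\<lambda>w. (norm (err t w))\<^sup>2)"
    by (rule integrableI_nonneg[OF meas]) (use le in \<open>auto simp: order_le_less_trans\<close>)
  have "ennreal (mean_err t) \<le> ennreal (\<integral>w. g w \<partial>P)"
    using le nn_integral_eq_integral[OF int] by (simp add: mean_err_def)
  moreover have "0 \<le> (\<integral>w. g w \<partial>P)"
    using assms(3) by (intro integral_nonneg_AE) auto
  ultimately show ?thesis
    using int by simp
qed

definition C :: real where "C = 2 * sqrt 2 * L\<^sup>2 * R\<^sup>2 + sig\<^sup>2"

text \<open>At \<open>t = 1\<close> the weight on the old momentum is 0, so only the gradient noise
  remains.\<close>

lemma mean_err_1: "integrable P (\<lambda>w. (norm (err 1 w))\<^sup>2) \<and> mean_err 1 \<le> sig\<^sup>2"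
  using error_integrable[of 1 "\<lambda>_. sig\<^sup>2"] by (simp add: prob_space)

text \<open>With q = (t+1)^(-1/2), convexity costs a factor at most 1/q on the drift of the
  gradient, while the squared drift is of order q^3; the result is of order q^2 = 1/(t+1), like the
  noise.\<close>

lemma mean_err_Suc:
  assumes t: "1 \<le> t" and int: "integrable P (\<lambda>w. (norm (err t w))\<^sup>2)"
  shows "integrable P (\<lambda>w. (norm (err (Suc t) w))\<^sup>2) \<and>
    mean_err (Suc t) \<le> (1 - real (Suc t) powr (- 1/2)) * mean_err t + C / real (Suc t)"
proof -
  let ?s = "real (Suc t)"
  define q where "q = ?s powr (- 1/2)"
  have q: "0 < q" "q \<le> 1" "q\<^sup>2 = 1 / ?s"
    using powr_mono[of "- 1/2" 0 ?s] by (auto simp: q_def powr_power powr_neg_one)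
  have q': "q < 1"
    using powr_less_mono[of "- 1/2" 0 ?s] t by (simp add: q_def)
  have drift: "(1 - q)\<^sup>2 / (1 - (1 - q)) * (L * (real t powr (- 3/4) * R))\<^sup>2 \<le> 2 * sqrt 2 * L\<^sup>2 * R\<^sup>2 / ?s"
  proof -
    have "(1 - q)\<^sup>2 / (1 - (1 - q)) \<le> 1 / q"
      using q by (simp add: divide_right_mono power_le_one)
    moreover have "(real t powr (- 3/4))\<^sup>2 \<le> 2 * sqrt 2 * q ^ 3"
    proof -
      have "(real t powr (- 3/4))\<^sup>2 = real t powr (- 3/2)"
        using t by (simp add: powr_power)
      \<comment> \<open>Since \<open>t\<close> is at least half of \<open>t + 1\<close>, the
        exponent -3/2 turns this 2 into the factor 2^(3/2).\<close>
      also have "\<dots> \<le> (?s / 2) powr (- 3/2)"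
        using t by (intro powr_mono2') auto
      also have "\<dots> = 2 powr (3/2) * ?s powr (- 3/2)"
        by (simp add: powr_divide powr_minus_divide)
      also have "2 powr (3/2) = 2 * sqrt (2 :: real)"
        using powr_add[of "2 :: real" 1 "1/2"] by (simp add: powr_half_sqrt)
      also have "?s powr (- 3/2) = q ^ 3"
        by (simp add: q_def powr_power)
      finally show ?thesis .
    qed
    ultimately have "(1 - q)\<^sup>2 / (1 - (1 - q)) * (L\<^sup>2 * R\<^sup>2 * (real t powr (- 3/4))\<^sup>2)
        \<le> 1 / q * (L\<^sup>2 * R\<^sup>2 * (2 * sqrt 2 * q ^ 3))"
      using q by (intro mult_mono mult_left_mono) auto
    also have "\<dots> = 2 * sqrt 2 * L\<^sup>2 * R\<^sup>2 * q\<^sup>2"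
      using q(1) by (simp add: power3_eq_cube power2_eq_square)
    finally show ?thesis
      by (simp add: q(3) power_mult_distrib mult_ac)
  qed
  define g where "g w = (1 - q) * (norm (err t w))\<^sup>2 + C / ?s" for w
  have "(norm ((1 - q) *\<^sub>R (gradf (X (Suc t) w) - M t w)))\<^sup>2 + sig\<^sup>2 / ?s \<le> g w" if w: "w \<in> space P" for w
  proof -
    have "(norm ((1 - q) *\<^sub>R (err t w + (gradf (X (Suc t) w) - gradf (X t w)))))\<^sup>2 \<le> (1 - q) * (norm (err t w))\<^sup>2
        + (1 - q)\<^sup>2 / (1 - (1 - q)) * (norm (gradf (X (Suc t) w) - gradf (X t w)))\<^sup>2"
      by (rule convex_norm_square) (use q in auto)
    also have "(1 - q)\<^sup>2 / (1 - (1 - q)) * (norm (gradf (X (Suc t) w) - gradf (X t w)))\<^sup>2 \<le>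
        (1 - q)\<^sup>2 / (1 - (1 - q)) * (L * (real t powr (- 3/4) * R))\<^sup>2"
    proof (intro mult_left_mono power_mono)
      show "norm (gradf (X (Suc t) w) - gradf (X t w)) \<le> L * (real t powr (- 3/4) * R)"
        using smooth[of "X (Suc t) w" "X t w"] mult_left_mono[OF step_le[OF t w] less_imp_le[OF L]]
        by (rule order_trans)
    qed (use q in auto)
    also note drift
    finally show ?thesis
      by (simp add: g_def C_def err_def add_divide_distrib)
  qed
  moreover have "integrable P g"
    unfolding g_def[abs_def] using int by simp
  moreover have "0 \<le> g w" for w
    using q by (simp add: g_def C_def)
  moreover have "(\<integral>w. g w \<partial>P) = (1 - q) * mean_err t + C / ?s"
    unfolding g_def using int by (simp add: mean_err_def prob_space)
  ultimately show ?thesis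
    using error_integrable[of "Suc t" g] by (simp add: q_def)
qed

lemma err_square_integrable: "1 \<le> t \<Longrightarrow> integrable P (\<lambda>w. (norm (err t w))\<^sup>2)"
  by (induction t rule: nat_induct_at_least) (auto simp: mean_err_1[simplified] mean_err_Suc)

lemma weighted_error_sum_le:
  assumes "1 \<le> T"
  shows "(\<Sum>t=1..T. real t powr (- 1/2) * mean_err t) \<le> 2 * (sig\<^sup>2 + C * (1 + ln (real T)))"
proof -
  have C: "0 \<le> C" by (simp add: C_def)
  have "(\<Sum>t=1..T. real t powr (- 1/2) * mean_err t) \<le> 2 * (sig\<^sup>2 + C * (\<Sum>t=1..T. 1 / real t))"
    by (rule momentum_recursion_sum)
      (use mean_err_nonneg mean_err_1 mean_err_Suc err_square_integrable C assms in auto)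
  also have "\<dots> \<le> 2 * (sig\<^sup>2 + C * (1 + ln (real T)))"
    using sum_inverse_le_ln[OF assms] C by (intro mult_left_mono add_left_mono) auto
  finally show ?thesis .
qed

lemma gradf_integrable:
  assumes "1 \<le> t"
  shows "integrable P (\<lambda>w. norm (gradf (X t w)))"
proof (rule integrable_const_bound)
  show "(\<lambda>w. norm (gradf (X t w))) \<in> borel_measurable P"
    using X_measurable[OF assms] by measurable
  show "AE w in P. norm (norm (gradf (X t w))) \<le>
      norm (gradf 0) + L * (norm X1 + 4 * (a * B) * (real t - 1) powr (1/4))"
  proof (rule AE_I2)
    fix w assume w: "w \<in> space P"
    have "norm (gradf (X t w)) \<le> norm (gradf 0) + norm (gradf (X t w) - gradf 0)"
      using norm_triangle_ineq[of "gradf 0" "gradf (X t w) - gradf 0"] by simp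
    also have "norm (gradf (X t w) - gradf 0) \<le> L * norm (X t w)"
      using smooth[where Z = "X t w" and Y = 0] by simp
    also have "L * norm (X t w) \<le> L * (norm X1 + 4 * (a * B) * (real t - 1) powr (1/4))"
      using L norm_X_le[OF assms w] by (intro mult_left_mono) auto
    finally show "norm (norm (gradf (X t w))) \<le>
      norm (gradf 0) + L * (norm X1 + 4 * (a * B) * (real t - 1) powr (1/4))"
      by simp
  qed
qed

section \<open>Descent in one step and the averaged rate\<close>

lemma one_step_descent:
  assumes t: "1 \<le> t" and w: "w \<in> space P" and \<kappa>: "0 \<le> \<kappa>"
    and align: "\<kappa> * norm (M t w) \<le> M t w \<bullet> U (M t w)"
  shows "real t powr (- 3/4) * (a * \<kappa> - rho) * norm (gradf (X t w)) \<le> f (X t w) - f (X (Suc t) w)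
    + a / 2 * L * (\<kappa> + B)\<^sup>2 * (1 / real t)
    + a / (2 * L) * (real t powr (- 1/2) * (norm (err t w))\<^sup>2)
    + L / 2 * R\<^sup>2 * real t powr (- 3/2)"
proof -
  \<comment> \<open>All exponents are multiples of -1/4, so in terms of \<open>p\<close> the
    estimate becomes polynomial algebra.\<close>
  define p where "p = real t powr (- 1/4)"
  have p: "0 < p" "real t powr (- 3/4) = p^3" "real t powr (- 1/2) = p\<^sup>2" "1 / real t = p^4"
    "real t powr (- 3/2) = (p^3)\<^sup>2"
    using t by (auto simp: p_def powr_power powr_neg_one)
  let ?g = "gradf (X t w)" and ?U = "U (M t w)"
  \<comment> \<open>Passing from momentum to gradient costs the error twice: \<open>\<kappa>\<close>
    in the norm of \<open>M\<close> and \<open>B\<close> in the inner product with the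
    direction.\<close>
  have inner: "\<kappa> * norm ?g - (\<kappa> + B) * norm (err t w) \<le> ?g \<bullet> ?U"
  proof -
    have "- (err t w \<bullet> ?U) \<le> norm (err t w) * B"
      using Cauchy_Schwarz_ineq2[of "err t w" ?U] mult_left_mono[OF norm_U[of "M t w"] norm_ge_zero, of "err t w"]
      by linarith
    moreover have "\<kappa> * (norm ?g - norm (err t w)) \<le> \<kappa> * norm (M t w)"
      using norm_triangle_ineq[of "M t w" "err t w"] \<kappa> by (intro mult_left_mono) (auto simp: err_def)
    moreover have "?g \<bullet> ?U = M t w \<bullet> ?U + err t w \<bullet> ?U"
      by (simp add: err_def inner_diff_left)
    ultimately show ?thesis
      using align by (simp add: algebra_simps)
  qed
  have "- (lam t * (?g \<bullet> X t w)) \<le> lam t * (norm ?g * norm (X t w))"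
    using Cauchy_Schwarz_ineq2[of ?g "X t w"] lam[OF t] mult_left_mono[of "- (?g \<bullet> X t w)" "norm ?g * norm (X t w)" "lam t"]
    by linarith
  also have "\<dots> = (lam t * norm (X t w)) * norm ?g" by simp
  also have "\<dots> \<le> rho * norm ?g"
    by (intro mult_right_mono lam_norm_X_le t w) simp
  finally have decay: "- (lam t * (?g \<bullet> X t w)) \<le> rho * norm ?g" .
  have "f (X (Suc t) w) \<le> f (X t w) + ?g \<bullet> (X (Suc t) w - X t w) + L / 2 * (norm (X (Suc t) w - X t w))\<^sup>2"
    by (rule descent_lemma[OF gradf smooth])
  also have "(norm (X (Suc t) w - X t w))\<^sup>2 \<le> (p^3 * R)\<^sup>2"
    using step_le[OF t w] unfolding p(2) by (intro power_mono) auto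
  also have "?g \<bullet> (X (Suc t) w - X t w) = p^3 * (- (lam t * (?g \<bullet> X t w)) - a * (?g \<bullet> ?U))"
    unfolding X_t[OF t w] p by (simp add: inner_diff_right algebra_simps)
  also have "\<dots> \<le> p^3 * (rho * norm ?g - a * (\<kappa> * norm ?g - (\<kappa> + B) * norm (err t w)))"
    using p(1) a decay inner by (intro mult_left_mono diff_mono) auto
  finally have "f (X (Suc t) w) \<le> f (X t w)
      + p^3 * (rho * norm ?g - a * (\<kappa> * norm ?g - (\<kappa> + B) * norm (err t w))) + L / 2 * (p^3 * R)\<^sup>2"
    using L by simp
  moreover have "a * p^3 * (\<kappa> + B) * norm (err t w) \<le>
      a / 2 * L * (\<kappa> + B)\<^sup>2 * p^4 + a / (2 * L) * (p\<^sup>2 * (norm (err t w))\<^sup>2)"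
  proof -
    have "0 \<le> a / (2 * L) * p\<^sup>2 * (L * (\<kappa> + B) * p - norm (err t w))\<^sup>2"
      using a L by simp
    also have "\<dots> = a / 2 * L * (\<kappa> + B)\<^sup>2 * p^4 + a / (2 * L) * (p\<^sup>2 * (norm (err t w))\<^sup>2)
        - a * p^3 * (\<kappa> + B) * norm (err t w)"
      using L by (simp add: power2_diff power_mult_distrib field_simps)
        (simp add: power2_eq_square power3_eq_cube power4_eq_xxxx algebra_simps)
    finally show ?thesis by simp
  qed
  ultimately show ?thesis
    unfolding p by (simp add: algebra_simps power_mult_distrib)
qed

theorem average_gradient_bound:
  assumes T: "1 \<le> T" and \<kappa>: "0 \<le> \<kappa>" "rho < a * \<kappa>"
    and align: "AE w in P. \<forall>t\<in>{1..T}. \<kappa> * norm (M t w) \<le> M t w \<bullet> U (M t w)"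
    and lower: "\<And>x. fstar \<le> f x"
  shows "(1 / real T) * (\<Sum>t=1..T. \<integral>w. norm (gradf (X t w)) \<partial>P) \<le>
    (f X1 - fstar + ((a / L) * C + a * L * (\<kappa> + B)\<^sup>2) * (1 + ln (real T))
       + (a * sig\<^sup>2 / L + (3 * L / 2) * R\<^sup>2)) / ((a * \<kappa> - rho) * real T powr (1/4))"
proof -
  let ?l = "1 + ln (real T)" and ?G = "\<lambda>t. \<integral>w. norm (gradf (X t w)) \<partial>P"
  let ?h = "\<lambda>t. real t powr (- 3/4)"
  have pos: "0 < a * \<kappa> - rho" using \<kappa> by simp
  have l: "0 \<le> ?l" using T by simp
  let ?lhs = "\<lambda>w. \<Sum>t=1..T. ?h t * (a * \<kappa> - rho) * norm (gradf (X t w))"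
  let ?rhs = "\<lambda>w. f X1 - fstar + a / 2 * L * (\<kappa> + B)\<^sup>2 * ?l
      + a / (2 * L) * (\<Sum>t=1..T. real t powr (- 1/2) * (norm (err t w))\<^sup>2) + L / 2 * R\<^sup>2 * 3"
  have "AE w in P. ?lhs w \<le> ?rhs w"
    using align
  proof (rule AE_mp, intro AE_I2 impI)
    fix w assume w: "w \<in> space P" and al: "\<forall>t\<in>{1..T}. \<kappa> * norm (M t w) \<le> M t w \<bullet> U (M t w)"
    have "?lhs w \<le> (\<Sum>t=1..T. f (X t w) - f (X (Suc t) w)
        + a / 2 * L * (\<kappa> + B)\<^sup>2 * (1 / real t)
        + a / (2 * L) * (real t powr (- 1/2) * (norm (err t w))\<^sup>2)
        + L / 2 * R\<^sup>2 * real t powr (- 3/2))"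
      using al by (intro sum_mono one_step_descent w \<kappa>) auto
    also have "\<dots> = (\<Sum>t=1..T. f (X t w) - f (X (Suc t) w))
        + a / 2 * L * (\<kappa> + B)\<^sup>2 * (\<Sum>t=1..T. 1 / real t)
        + a / (2 * L) * (\<Sum>t=1..T. real t powr (- 1/2) * (norm (err t w))\<^sup>2)
        + L / 2 * R\<^sup>2 * (\<Sum>t=1..T. real t powr (- 3/2))"
      by (simp only: sum.distrib sum_distrib_left)
    also have "(\<Sum>t=1..T. f (X t w) - f (X (Suc t) w)) \<le> f X1 - fstar"
    proof -
      have "(\<Sum>t=1..T. f (X t w) - f (X (Suc t) w)) = f (X 1 w) - f (X (Suc T) w)" for T
        by (induction T) auto
      then show ?thesis using lower[of "X (Suc T) w"] X_1[OF w] by simp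
    qed
    also have "a / 2 * L * (\<kappa> + B)\<^sup>2 * (\<Sum>t=1..T. 1 / real t) \<le> a / 2 * L * (\<kappa> + B)\<^sup>2 * ?l"
      using a L sum_inverse_le_ln[OF T] by (intro mult_left_mono) auto
    also have "L / 2 * R\<^sup>2 * (\<Sum>t=1..T. real t powr (- 3/2)) \<le> L / 2 * R\<^sup>2 * 3"
      using L sum_powr_neg_three_halves_le[OF T] by (intro mult_left_mono) auto
    finally show "?lhs w \<le> ?rhs w" by simp
  qed
  moreover have int_lhs: "integrable P ?lhs"
    by (intro Bochner_Integration.integrable_sum integrable_mult_right gradf_integrable) auto
  moreover have int_err: "integrable P (\<lambda>w. \<Sum>t=1..T. real t powr (- 1/2) * (norm (err t w))\<^sup>2)"
    by (intro Bochner_Integration.integrable_sum integrable_mult_right err_square_integrable) auto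
  moreover have int_rhs: "integrable P ?rhs"
    by (intro Bochner_Integration.integrable_add integrable_mult_right int_err) auto
  ultimately have "(\<integral>w. ?lhs w \<partial>P) \<le> (\<integral>w. ?rhs w \<partial>P)"
    by (intro integral_mono_AE)
  also have "(\<integral>w. ?lhs w \<partial>P) = (\<Sum>t=1..T. ?h t * (a * \<kappa> - rho) * ?G t)"
    using gradf_integrable by (subst Bochner_Integration.integral_sum) auto
  also have "(\<integral>w. ?rhs w \<partial>P) = f X1 - fstar + a / 2 * L * (\<kappa> + B)\<^sup>2 * ?l
      + a / (2 * L) * (\<Sum>t=1..T. real t powr (- 1/2) * mean_err t) + L / 2 * R\<^sup>2 * 3"
  proof -
    have "(\<integral>w. (\<Sum>t=1..T. real t powr (- 1/2) * (norm (err t w))\<^sup>2) \<partial>P) = (\<Sum>t=1..T. real t powr (- 1/2) * mean_err t)"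
      using err_square_integrable by (subst Bochner_Integration.integral_sum) (auto simp: mean_err_def)
    then show ?thesis
      using int_err by (simp add: prob_space)
  qed
  \<comment> \<open>The first term is doubled to match the stated constant; in the second, the 2
    from the error sum cancels the 1/2 from Young's inequality.\<close>
  also have "\<dots> \<le> f X1 - fstar + a * L * (\<kappa> + B)\<^sup>2 * ?l
      + a / (2 * L) * (2 * (sig\<^sup>2 + C * ?l)) + L / 2 * R\<^sup>2 * 3"
  proof -
    have "a / 2 * L * (\<kappa> + B)\<^sup>2 * ?l \<le> a * L * (\<kappa> + B)\<^sup>2 * ?l"
      using a L l by (intro mult_right_mono) auto
    moreover have "a / (2 * L) * (\<Sum>t=1..T. real t powr (- 1/2) * mean_err t) \<le> a / (2 * L) * (2 * (sig\<^sup>2 + C * ?l))"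
      using a L weighted_error_sum_le[OF T] by (intro mult_left_mono) auto
    ultimately show ?thesis by linarith
  qed
  also have "\<dots> = f X1 - fstar + ((a / L) * C + a * L * (\<kappa> + B)\<^sup>2) * ?l
       + (a * sig\<^sup>2 / L + (3 * L / 2) * R\<^sup>2)" (is "_ = ?num")
    using L by (simp add: field_simps)
  finally have main: "(\<Sum>t=1..T. ?h t * (a * \<kappa> - rho) * ?G t) \<le> ?num" .
  \<comment> \<open>Step sizes decrease, so the last one bounds all others from below; T times it is
    T^(1/4).\<close>
  have "?h T * (a * \<kappa> - rho) * (\<Sum>t=1..T. ?G t) \<le> (\<Sum>t=1..T. ?h t * (a * \<kappa> - rho) * ?G t)"
    unfolding sum_distrib_left
    using pos by (intro sum_mono mult_right_mono powr_mono2') auto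
  with main have "?h T * (a * \<kappa> - rho) * (\<Sum>t=1..T. ?G t) \<le> ?num" by linarith
  moreover have "?h T = real T powr (1/4) / real T"
    using T powr_diff[of "real T" "1/4" 1] by simp
  ultimately have "(1 / real T * (\<Sum>t=1..T. ?G t)) * ((a * \<kappa> - rho) * real T powr (1/4)) \<le> ?num"
    by (simp add: mult_ac)
  then show ?thesis
    using pos T by (subst pos_le_divide_eq) auto
qed

end

theorem corollary3p6:
  fixes f :: "real ^ 'n ^ 'm \<Rightarrow> real"
    and gradf :: "real ^ 'n ^ 'm \<Rightarrow> real ^ 'n ^ 'm"
    and fs :: "real ^ 'n ^ 'm \<Rightarrow> 's \<Rightarrow> real"
    and gradfs :: "real ^ 'n ^ 'm \<Rightarrow> 's \<Rightarrow> real ^ 'n ^ 'm"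
    and D :: "'s measure" and P :: "'w measure"
    and xi :: "nat \<Rightarrow> 'w \<Rightarrow> 's"
    and X G M Mh Q :: "nat \<Rightarrow> 'w \<Rightarrow> real ^ 'n ^ 'm"
    and X1 :: "real ^ 'n ^ 'm"
    and eta beta lam :: "nat \<Rightarrow> real"
    and m n a L sig fstar :: real and T :: nat
  assumes m: "m = real CARD('m)" and n: "n = real CARD('n)"
    and dims: "CARD('m) \<ge> CARD('n)"
    \<comment> \<open>the stochastic objective\<close>
    and D: "prob_space D"
    and f: "\<And>Y. has_bochner_integral D (fs Y) (f Y)"
    and gradf: "\<And>Y. GDERIV f Y :> gradf Y"
    and gradfs: "\<And>Y s. s \<in> space D \<Longrightarrow> GDERIV (\<lambda>Z. fs Z s) Y :> gradfs Y s"
    \<comment> \<open>assumptions (1), (2), (3)\<close>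
    and lower: "\<And>Y. f Y \<ge> fstar"
    and L: "L > 0"
    and smooth: "\<And>Y Z. norm (gradf Z - gradf Y) \<le> L * norm (Z - Y)"
    and sig: "sig > 0"
    and unbiased: "\<And>Y. has_bochner_integral D (gradfs Y) (gradf Y)"
    and variance_integrable: "\<And>Y. integrable D (\<lambda>s. (norm (gradfs Y s - gradf Y))\<^sup>2)"
    and variance: "\<And>Y. (\<integral>s. (norm (gradfs Y s - gradf Y))\<^sup>2 \<partial>D) \<le> sig\<^sup>2"
    \<comment> \<open>the samples: independent, each with law D\<close>
    and P: "prob_space P"
    and indep: "prob_space.indep_vars P (\<lambda>_. D) xi {1..}"
    and law: "\<And>t. t \<ge> 1 \<Longrightarrow> distr P D (xi t) = D"
    \<comment> \<open>the algorithm\<close>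
    and eta: "\<And>t. t \<ge> 1 \<Longrightarrow> eta t = real t powr (- 3/4)"
    and beta: "\<And>t. t \<ge> 1 \<Longrightarrow> beta t = 1 - real t powr (- 1/2)"
    and a: "a = 0.2 * sqrt (max m n)"
    and M_0: "\<And>w. w \<in> space P \<Longrightarrow> M 0 w = 0"
    and X_1: "\<And>w. w \<in> space P \<Longrightarrow> X 1 w = X1"
    and G_t: "\<And>t w. t \<ge> 1 \<Longrightarrow> w \<in> space P \<Longrightarrow> G t w = gradfs (X t w) (xi t w)"
    and M_t: "\<And>t w. t \<ge> 1 \<Longrightarrow> w \<in> space P \<Longrightarrow>
                M t w = beta t *\<^sub>R M (t - 1) w + (1 - beta t) *\<^sub>R G t w"
    and Mh_t: "\<And>t w. t \<ge> 1 \<Longrightarrow> w \<in> space P \<Longrightarrow> Mh t w = row_normalize (M t w)"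
    and Q_t: "\<And>t w. t \<ge> 1 \<Longrightarrow> w \<in> space P \<Longrightarrow> Q t w = NS5 (Mh t w)"
    and X_t: "\<And>t w. t \<ge> 1 \<Longrightarrow> w \<in> space P \<Longrightarrow>
                X (t + 1) w = (1 - lam t * eta t) *\<^sub>R X t w - (a * eta t) *\<^sub>R Q t w"
    and T: "T \<ge> 1"
  shows
    "(\<forall>w\<in>space P. ns_error T (\<lambda>t. Mh t w) < 1) \<and>
     (\<forall>eps rho.
        (AE w in P. ns_error T (\<lambda>t. Mh t w) \<le> eps) \<and>
        0 \<le> rho \<and> rho < a * (1 - eps) / sqrt m \<and>
        (\<forall>t\<ge>1. 0 \<le> lam t \<and>
           lam t \<le> rho / (norm X1 + 4 * a * (1 + eps) * sqrt n) * real t powr (- 1/4))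
        \<longrightarrow>
        (\<forall>t\<in>{1..T}. integrable P (\<lambda>w. norm (gradf (X t w)))) \<and>
        (1 / real T) * (\<Sum>t=1..T. \<integral>w. norm (gradf (X t w)) \<partial>P)
          \<le> (f X1 - fstar + C1_ns m n a L sig eps rho * (1 + ln (real T))
                + C2_ns n a L sig eps rho)
             / ((a * (1 - eps) / sqrt m - rho) * real T powr (1/4)))"
proof (intro conjI ballI allI impI)
  have fin: "finite ((\<lambda>t. op_norm (NS5 (Mh t w) - Orth (Mh t w))) ` {1..T})"
    "(\<lambda>t. op_norm (NS5 (Mh t w) - Orth (Mh t w))) ` {1..T} \<noteq> {}" for w
    using T by auto
  show "ns_error T (\<lambda>t. Mh t w) < 1" for w
    unfolding ns_error_def Max_less_iff[OF fin] by (auto intro: op_norm_NS5_minus_Orth_less_1)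
  have ns_error_ge: "op_norm (NS5 (Mh t w) - Orth (Mh t w)) \<le> ns_error T (\<lambda>t. Mh t w)"
    if "t \<in> {1..T}" for t w
    unfolding ns_error_def using that by (intro Max_ge) auto
  fix eps rho
  assume "(AE w in P. ns_error T (\<lambda>t. Mh t w) \<le> eps) \<and>
    0 \<le> rho \<and> rho < a * (1 - eps) / sqrt m \<and>
    (\<forall>t\<ge>1. 0 \<le> lam t \<and>
      lam t \<le> rho / (norm X1 + 4 * a * (1 + eps) * sqrt n) * real t powr (- 1/4))"
  then have AE_eps: "AE w in P. ns_error T (\<lambda>t. Mh t w) \<le> eps"
    and rho: "0 \<le> rho" "rho < a * (1 - eps) / sqrt m"
    and lam: "\<And>t. 1 \<le> t \<Longrightarrow> 0 \<le> lam t \<and>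
      lam t \<le> rho / (norm X1 + 4 * a * (1 + eps) * sqrt n) * real t powr (- 1/4)"
    by auto
  interpret P: prob_space P by (rule P)
  define B where "B = (1 + eps) * sqrt n"
  define \<kappa> where "\<kappa> = (1 - eps) / sqrt m"
  have mn: "1 \<le> m" "1 \<le> n"
    by (simp_all add: m n Suc_le_eq)
  then have a_pos: "0 < a"
    by (simp add: a)
  \<comment> \<open>A negative \<open>eps\<close> would contradict the nonnegative
    \<open>ns_error\<close> at every outcome, which an almost sure bound on a probability space
    excludes.\<close>
  have eps0: "0 \<le> eps"
  proof (rule ccontr)
    assume "\<not> 0 \<le> eps"
    moreover have "0 \<le> ns_error T (\<lambda>t. Mh t w)" for w
      using ns_error_ge[of 1 w] op_norm_nonneg[of "NS5 (Mh 1 w) - Orth (Mh 1 w)"] T by auto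
    ultimately have "\<not> ns_error T (\<lambda>t. Mh t w) \<le> eps" for w
      by (meson order_trans)
    then show False
      using AE_eps by simp
  qed
  have eps1: "eps < 1"
  proof (rule ccontr)
    assume "\<not> eps < 1"
    then have "a * (1 - eps) / sqrt m \<le> 0"
      using a_pos mn by (intro divide_nonpos_nonneg mult_nonneg_nonpos) auto
    then show False using rho by linarith
  qed
  have B: "1 \<le> B"
    using mult_mono[of 1 "1 + eps" 1 "sqrt n"] eps0 mn by (simp add: B_def)
  have \<kappa>: "0 \<le> \<kappa>" "\<kappa> \<le> 1" "rho < a * \<kappa>"
    using eps0 eps1 mn rho order_trans[of "1 - eps" 1 "sqrt m"]
    by (simp_all add: \<kappa>_def divide_le_eq_1)
  \<comment> \<open>The chain is rho < a kappa <= a <= a B, since kappa is at most 1 and B at least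
    1.\<close>
  have rho_le: "rho \<le> 4 * (a * B)"
  proof -
    have "a * \<kappa> \<le> a * B"
      using \<kappa> B a_pos by (intro mult_left_mono) auto
    moreover have "0 \<le> a * B"
      using B a_pos by simp
    ultimately show ?thesis
      using \<kappa>(3) by linarith
  qed
  interpret momentum_method P D f gradf gradfs xi X M "\<lambda>x. NS5 (row_normalize x)" X1 lam a B rho L sig
  proof (intro momentum_method.intro momentum_method_axioms.intro)
    show "(\<lambda>(x, s). gradfs x s) \<in> borel_measurable (borel \<Otimes>\<^sub>M D)"
      by (rule borel_measurable_gderiv[of fs])
        (use f gradfs in \<open>auto simp: has_bochner_integral_iff\<close>)
    \<comment> \<open>The bound \<open>sqrt n\<close> is relaxed to
      \<open>(1 + eps) * sqrt n\<close> so that the locale's constants become those of the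
      statement.\<close>
    show "norm (NS5 (row_normalize x)) \<le> B" for x :: "real ^ 'n ^ 'm"
    proof -
      have "1 * sqrt n \<le> B"
        unfolding B_def using eps0 mn by (intro mult_right_mono) auto
      then show ?thesis
        using norm_NS5_le[of "row_normalize x"] by (simp add: n)
    qed
    show "M t w = (1 - real t powr (- 1/2)) *\<^sub>R M (t - 1) w + real t powr (- 1/2) *\<^sub>R gradfs (X t w) (xi t w)"
      if "1 \<le> t" "w \<in> space P" for t w
      using M_t[OF that] G_t[OF that] beta[OF that(1)] by simp
    show "X (Suc t) w = (1 - lam t * real t powr (- 3/4)) *\<^sub>R X t w
        - (a * real t powr (- 3/4)) *\<^sub>R NS5 (row_normalize (M t w))"
      if "1 \<le> t" "w \<in> space P" for t w
      using X_t[OF that] Q_t[OF that] Mh_t[OF that] eta[OF that(1)] by simp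
    show "0 \<le> lam t \<and> lam t \<le> rho / (norm X1 + 4 * (a * B)) * real t powr (- 1/4)" if "1 \<le> t" for t
      using lam[OF that] by (simp add: B_def mult.assoc)
    show "(\<lambda>x. NS5 (row_normalize x)) \<in> borel_measurable borel"
      by measurable
    show "0 < B"
      using B by simp
    show "distr P D (xi t) = D" if "1 \<le> t" for t
      using that by (rule law)
  qed (fact P D gradf L smooth unbiased variance_integrable variance indep M_0 X_1 a_pos rho rho_le)+
  have align: "AE w in P. \<forall>t\<in>{1..T}. \<kappa> * norm (M t w) \<le> M t w \<bullet> NS5 (row_normalize (M t w))"
    using AE_eps
  proof (rule AE_mp, intro AE_I2 impI ballI)
    fix w t assume w: "w \<in> space P" and le: "ns_error T (\<lambda>t. Mh t w) \<le> eps" and t: "t \<in> {1..T}"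
    then have "op_norm (NS5 (row_normalize (M t w)) - Orth (row_normalize (M t w))) \<le> eps"
      using ns_error_ge[OF t, of w] Mh_t[of t w] by simp
    then show "\<kappa> * norm (M t w) \<le> M t w \<bullet> NS5 (row_normalize (M t w))"
      unfolding \<kappa>_def m using eps1 by (rule inner_NS5_row_normalize_ge)
  qed
  show "integrable P (\<lambda>w. norm (gradf (X t w)))" if "t \<in> {1..T}" for t
    using gradf_integrable[of t] that by simp
  have R: "R = a * (1 + eps) * sqrt n + rho"
    unfolding R_def by (simp add: B_def mult.assoc)
  have C1: "C1_ns m n a L sig eps rho = (a / L) * C + a * L * (\<kappa> + B)\<^sup>2"
    unfolding C1_ns_def C_def R by (simp add: \<kappa>_def B_def)
  have C2: "C2_ns n a L sig eps rho = a * sig\<^sup>2 / L + (3 * L / 2) * R\<^sup>2"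
    unfolding C2_ns_def R ..
  have "a * (1 - eps) / sqrt m = a * \<kappa>"
    by (simp add: \<kappa>_def)
  then show "(1 / real T) * (\<Sum>t=1..T. \<integral>w. norm (gradf (X t w)) \<partial>P)
          \<le> (f X1 - fstar + C1_ns m n a L sig eps rho * (1 + ln (real T))
                + C2_ns n a L sig eps rho)
             / ((a * (1 - eps) / sqrt m - rho) * real T powr (1/4))"
    using average_gradient_bound[OF T \<kappa>(1,3) align lower] unfolding C1 C2 by simp
qed

end
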